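(* For every integer $n\ge 5$, $$p_n^*\le b_n-4\quad\text{and}\quad p_n\le b_n-3 .$$
   Context: An $n\times n$ matrix $M$ is completely positive if $M=VV^\top$ for some entrywise nonnegative, not necessarily square, matrix $V$. $\mathcal{C}_n^*$ denotes the cone of completely positive $n\times n$ matrices, and $\mathrm{bd}\,\mathcal{C}_n^*$ its boundary in the space of real symmetric $n\times n$ matrices. The cp-rank $\mathrm{cpr}\,M$ of a nonzero completely positive matrix $M$ is the minimum number of columns of an entrywise nonnegative $V$ with $M=VV^\top$; $\mathrm{cpr}\,0=0$. Define $p_n=\max\{\mathrm{cpr}\,M : M\in\mathcal{C}_n^*\}$, $p_n^*=\max\{\mathrm{cpr}\,M : M\in\mathrm{bd}\,\mathcal{C}_n^*,\ \min_{i,j}M_{ij}>0\}$, and $b_r=\max\{\mathrm{cpr}\,M : M\text{ is a completely positive matrix (of any order) with }\mathrm{rank}\,M=r\}$. It is known (Barioli–Berman) that $b_r=\binom{r+1}{2}-1$ for $r\ge 3$. *)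

theory Defs
  imports "HOL-Analysis.Abstract_Metric_Spaces" "HOL-Analysis.L2_Norm"
    "Jordan_Normal_Form.DL_Rank"
begin

definition nonneg_mat :: "real mat \<Rightarrow> bool" where
  "nonneg_mat V \<longleftrightarrow> (\<forall>i<dim_row V. \<forall>j<dim_col V. 0 \<le> V $$ (i, j))"

text \<open>The cone of completely positive matrices of order \<open>n\<close>; the number \<open>k\<close> of columns of the
  factor is unrestricted.\<close>

definition cp_cone :: "nat \<Rightarrow> real mat set" where
  "cp_cone n = {M. \<exists>k. \<exists>V \<in> carrier_mat n k. nonneg_mat V \<and> M = V * transpose_mat V}"

text \<open>Only meaningful for completely positive \<open>M\<close>. The value \<open>k = 0\<close> is allowed: if \<open>V\<close> has no columns
  then \<open>V * transpose_mat V\<close> is the zero matrix, so zero matrices, and only these, have cp-rank 0.\<close>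

definition cp_rank :: "real mat \<Rightarrow> nat" where
  "cp_rank M = (LEAST k. \<exists>V \<in> carrier_mat (dim_row M) k. nonneg_mat V \<and> M = V * transpose_mat V)"

definition sym_mats :: "nat \<Rightarrow> real mat set" where
  "sym_mats n = {M \<in> carrier_mat n n. transpose_mat M = M}"

definition frobenius_dist :: "nat \<Rightarrow> real mat \<Rightarrow> real mat \<Rightarrow> real" where
  "frobenius_dist n A B =
     L2_set (\<lambda>(i, j). A $$ (i, j) - B $$ (i, j)) ({..<n} \<times> {..<n})"

lemma Metric_space_sym_mats: "Metric_space (sym_mats n) (frobenius_dist n)"
proof
  fix A B C :: "real mat"
  show "0 \<le> frobenius_dist n A B"
    by (simp add: frobenius_dist_def)
  show "frobenius_dist n A B = frobenius_dist n B A"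
    by (simp add: frobenius_dist_def L2_set_def case_prod_unfold power2_commute)
  show "frobenius_dist n A B = 0 \<longleftrightarrow> A = B" if "A \<in> sym_mats n" "B \<in> sym_mats n"
    using that by (auto simp: frobenius_dist_def L2_set_eq_0_iff sym_mats_def)
  have "frobenius_dist n A C =
      L2_set (\<lambda>p. (case p of (i, j) \<Rightarrow> A $$ (i, j) - B $$ (i, j)) +
                  (case p of (i, j) \<Rightarrow> B $$ (i, j) - C $$ (i, j))) ({..<n} \<times> {..<n})"
    unfolding frobenius_dist_def by (rule L2_set_cong) auto
  then show "frobenius_dist n A C \<le> frobenius_dist n A B + frobenius_dist n B C"
    unfolding frobenius_dist_def by (simp only: L2_set_triangle_ineq)
qed

text \<open>The usual topology of the space of real symmetric matrices of order \<open>n\<close>.\<close>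

definition sym_topology :: "nat \<Rightarrow> real mat topology" where
  "sym_topology n = Metric_space.mtopology (sym_mats n) (frobenius_dist n)"

definition bd_cp_cone :: "nat \<Rightarrow> real mat set" where
  "bd_cp_cone n = sym_topology n frontier_of cp_cone n"

text \<open>\<open>Max\<close> is unspecified on empty and on infinite sets. The sets below are finite by Caratheodory's
  theorem; that of \<open>p_star_max n\<close> is nonempty for \<open>n \<ge> 5\<close>.\<close>

definition p_max :: "nat \<Rightarrow> nat" where
  "p_max n = Max (cp_rank ` cp_cone n)"

definition p_star_max :: "nat \<Rightarrow> nat" where
  "p_star_max n = Max (cp_rank ` {M \<in> bd_cp_cone n. \<forall>i<n. \<forall>j<n. M $$ (i, j) > 0})"

text \<open>Here the rank \<open>r\<close> is fixed and the order \<open>m\<close> is arbitrary; \<open>vec_space.rank m\<close> is the dimension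
  of the column span of a matrix with \<open>m\<close> rows.\<close>

definition b_max :: "nat \<Rightarrow> nat" where
  "b_max r = Max {cp_rank M | M m. M \<in> cp_cone m \<and> vec_space.rank m M = r}"

end

theory Submission
  imports Defs
begin

text \<open>Write \<open>N = n (n + 1) / 2\<close>. A completely positive \<open>A\<close> on the boundary of the cone is orthogonal to
  some copositive \<open>S \<noteq> 0\<close>, so every vector \<open>v\<close> in a factorization of \<open>A\<close> is a zero of \<open>S\<close> and satisfies
  \<open>v\<^sub>i (S v)\<^sub>i = 0\<close>. If all entries of \<open>A\<close> are positive, then \<open>S\<^sub>i\<^sub>i = 0\<close> forces row \<open>i\<close> of \<open>S\<close> to
  vanish, and for \<open>S\<^sub>i\<^sub>i > 0\<close> these equations express the \<open>i\<close>-th diagonal entry of any combination of the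
  \<open>v v\<^sup>T\<close> through its off-diagonal entries. With at least five nonzero rows, Caratheodory's argument saves
  five columns from \<open>N\<close>. With at most four, \<open>S\<close> is positive semidefinite, so \<open>A\<close> is singular and \<open>N - n\<close>
  columns suffice.

  A matrix with positive entries becomes a boundary matrix with positive entries after subtracting
  a multiple of \<open>e\<^sub>0 e\<^sub>0\<^sup>T\<close>, at the price of one column. Since the matrices of cp-rank at most \<open>k\<close> form a closed
  set, the resulting bound \<open>N - 4\<close> extends to all completely positive matrices.

  It remains to find a completely positive matrix of rank \<open>n\<close> and cp-rank at least \<open>N - 1\<close>. Take a polyhedral
  cone on which a quadratic form is nonnegative and vanishes only on \<open>N - 1\<close> rays with linearly
  independent outer products, and sum these outer products in the coordinates given by the facets.\<close>

section \<open>Completely positive decompositions and Caratheodory's theorem\<close>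

text \<open>Matrices and vectors are functions of which only the values at indices below
  \<open>n\<close> matter. The index set \<open>L\<close> is an arbitrary finite set, so that
  dropping a vector needs no renumbering.\<close>

definition cp_decomp :: "nat \<Rightarrow> nat set \<Rightarrow> (nat \<Rightarrow> nat \<Rightarrow> real) \<Rightarrow> (nat \<Rightarrow> nat \<Rightarrow> real) \<Rightarrow> bool" where
  "cp_decomp n L v A \<longleftrightarrow> finite L \<and> (\<forall>l\<in>L. \<forall>i<n. 0 \<le> v l i) \<and>
     (\<forall>i<n. \<forall>j<n. A i j = (\<Sum>l\<in>L. v l i * v l j))"

definition cp_le :: "nat \<Rightarrow> nat \<Rightarrow> (nat \<Rightarrow> nat \<Rightarrow> real) \<Rightarrow> bool" where
  "cp_le n k A \<longleftrightarrow> (\<exists>L v. cp_decomp n L v A \<and> card L \<le> k)"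

lemma cp_decompD:
  assumes "cp_decomp n L v A"
  shows "finite L" "\<And>l i. l \<in> L \<Longrightarrow> i < n \<Longrightarrow> 0 \<le> v l i"
    "\<And>i j. i < n \<Longrightarrow> j < n \<Longrightarrow> A i j = (\<Sum>l\<in>L. v l i * v l j)"
  using assms by (auto simp: cp_decomp_def)

lemma cp_le_mono: "cp_le n k A \<Longrightarrow> k \<le> k' \<Longrightarrow> cp_le n k' A"
  by (meson cp_le_def le_trans)

lemma cp_le_cong:
  assumes "\<And>i j. i < n \<Longrightarrow> j < n \<Longrightarrow> A i j = B i j"
  shows "cp_le n k A \<longleftrightarrow> cp_le n k B"
  using assms by (simp add: cp_le_def cp_decomp_def)

lemma cp_decomp_reindex:
  assumes "cp_decomp n L v A" "bij_betw f L' L"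
  shows "cp_decomp n L' (\<lambda>l. v (f l)) A"
proof -
  have "(\<Sum>l\<in>L. v l i * v l j) = (\<Sum>l\<in>L'. v (f l) i * v (f l) j)" for i j
    using sum.reindex_bij_betw[OF assms(2), of "\<lambda>l. v l i * v l j"] by simp
  then show ?thesis
    using assms bij_betw_finite[OF assms(2)] bij_betwE[OF assms(2)]
    by (auto simp: cp_decomp_def)
qed

text \<open>Padding with zero vectors turns "at most \<open>k\<close> vectors" into a family over
  the fixed index set \<open>{..<k}\<close>. The compactness arguments need one index set for a
  whole sequence of matrices.\<close>

lemma cp_le_lessThan: "cp_le n k A \<longleftrightarrow> (\<exists>v. cp_decomp n {..<k} v A)"
proof
  assume "cp_le n k A"
  then obtain L v where Lv: "cp_decomp n L v A" "card L \<le> k"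
    by (auto simp: cp_le_def)
  have fin: "finite L" using Lv(1) by (rule cp_decompD)
  then obtain f where f: "bij_betw f {..<card L} L"
    using ex_bij_betw_nat_finite[of L] atLeast0LessThan by auto
  have d: "cp_decomp n {..<card L} (\<lambda>l. v (f l)) A"
    by (rule cp_decomp_reindex[OF Lv(1) f])
  have "cp_decomp n {..<k} (\<lambda>l. if l < card L then v (f l) else (\<lambda>_. 0)) A"
  proof -
    have "(\<Sum>l<k. (if l < card L then v (f l) else (\<lambda>_. 0)) i * (if l < card L then v (f l) else (\<lambda>_. 0)) j)
        = (\<Sum>l<card L. v (f l) i * v (f l) j)" for i j
      using Lv(2) by (intro sum.mono_neutral_cong_right) auto
    then show ?thesis using d by (auto simp: cp_decomp_def)
  qed
  then show "\<exists>v. cp_decomp n {..<k} v A" by blast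
next
  assume "\<exists>v. cp_decomp n {..<k} v A"
  then show "cp_le n k A" unfolding cp_le_def by (metis card_lessThan order_refl)
qed

lemma mat_factorization_iff_cp_le:
  assumes "M \<in> carrier_mat n n"
  shows "(\<exists>V\<in>carrier_mat n k. nonneg_mat V \<and> M = V * transpose_mat V) \<longleftrightarrow>
    cp_le n k (\<lambda>i j. M $$ (i, j))"
proof
  assume "\<exists>V\<in>carrier_mat n k. nonneg_mat V \<and> M = V * transpose_mat V"
  then obtain V where V: "V \<in> carrier_mat n k" "nonneg_mat V" "M = V * transpose_mat V" by blast
  have "M $$ (i, j) = (\<Sum>l<k. V $$ (i, l) * V $$ (j, l))" if "i < n" "j < n" for i j
    using that V(1) by (simp add: V(3) scalar_prod_def atLeast0LessThan)
  then have "cp_decomp n {..<k} (\<lambda>l i. V $$ (i, l)) (\<lambda>i j. M $$ (i, j))"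
    using V(1,2) by (auto simp: cp_decomp_def nonneg_mat_def)
  then show "cp_le n k (\<lambda>i j. M $$ (i, j))" unfolding cp_le_lessThan by blast
next
  assume "cp_le n k (\<lambda>i j. M $$ (i, j))"
  then obtain v where v: "cp_decomp n {..<k} v (\<lambda>i j. M $$ (i, j))"
    unfolding cp_le_lessThan by blast
  define V where "V = mat n k (\<lambda>(i, l). v l i)"
  have "V \<in> carrier_mat n k" "nonneg_mat V"
    using v by (auto simp: V_def nonneg_mat_def cp_decomp_def)
  moreover have "M = V * transpose_mat V"
  proof (rule eq_matI)
    fix i j assume "i < dim_row (V * transpose_mat V)" "j < dim_col (V * transpose_mat V)"
    then have "i < n" "j < n" by (auto simp: V_def)
    then show "M $$ (i, j) = (V * transpose_mat V) $$ (i, j)"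
      using v by (simp add: V_def cp_decomp_def scalar_prod_def atLeast0LessThan)
  qed (use assms in \<open>auto simp: V_def\<close>)
  ultimately show "\<exists>V\<in>carrier_mat n k. nonneg_mat V \<and> M = V * transpose_mat V" by blast
qed

lemma cp_cone_iff_cp_le:
  "M \<in> cp_cone n \<longleftrightarrow> M \<in> carrier_mat n n \<and> (\<exists>k. cp_le n k (\<lambda>i j. M $$ (i, j)))"
proof
  assume M: "M \<in> cp_cone n"
  then have c: "M \<in> carrier_mat n n" by (auto simp: cp_cone_def)
  then show "M \<in> carrier_mat n n \<and> (\<exists>k. cp_le n k (\<lambda>i j. M $$ (i, j)))"
    using M mat_factorization_iff_cp_le[OF c] by (auto simp: cp_cone_def)
next
  assume "M \<in> carrier_mat n n \<and> (\<exists>k. cp_le n k (\<lambda>i j. M $$ (i, j)))"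
  then show "M \<in> cp_cone n" using mat_factorization_iff_cp_le[of M n] by (auto simp: cp_cone_def)
qed

lemma cp_rank_le_iff:
  assumes "M \<in> cp_cone n"
  shows "cp_rank M \<le> k \<longleftrightarrow> cp_le n k (\<lambda>i j. M $$ (i, j))"
proof -
  have c: "M \<in> carrier_mat n n" and ex: "\<exists>k. cp_le n k (\<lambda>i j. M $$ (i, j))"
    using assms by (auto simp: cp_cone_iff_cp_le)
  have r: "cp_rank M = (LEAST k. cp_le n k (\<lambda>i j. M $$ (i, j)))"
    unfolding cp_rank_def using c mat_factorization_iff_cp_le[OF c] by simp
  show ?thesis
    unfolding r using ex by (metis LeastI Least_le cp_le_mono)
qed

text \<open>Gaussian elimination: by induction on the equations, an unknown \<open>p\<close> with
  nonzero coefficient in the equation \<open>e\<close> is eliminated from all the others.\<close>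

lemma homogeneous_system_nontrivial:
  fixes a :: "'e \<Rightarrow> 'l \<Rightarrow> 'a::field"
  assumes "finite E" "finite L" "card E < card L"
  shows "\<exists>c. (\<exists>l\<in>L. c l \<noteq> 0) \<and> (\<forall>e\<in>E. (\<Sum>l\<in>L. a e l * c l) = 0)"
  using assms
proof (induction E arbitrary: L a rule: finite_induct)
  case empty
  then show ?case by (intro exI[of _ "\<lambda>_. 1"]) (auto simp: card_gt_0_iff)
next
  case (insert e E)
  show ?case
  proof (cases "\<forall>l\<in>L. a e l = 0")
    case True
    obtain c where "\<exists>l\<in>L. c l \<noteq> 0" "\<forall>e\<in>E. (\<Sum>l\<in>L. a e l * c l) = 0"
      using insert.IH[of L a] insert.prems insert.hyps by auto
    then show ?thesis using True by (intro exI[of _ c]) auto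
  next
    case False
    then obtain p where p: "p \<in> L" "a e p \<noteq> 0" by blast
    have card: "card E < card (L - {p})"
      using insert.prems insert.hyps p by simp
    obtain c where c: "\<exists>l\<in>L - {p}. c l \<noteq> 0"
      "\<forall>e'\<in>E. (\<Sum>l\<in>L - {p}. (a e' l - a e' p * a e l / a e p) * c l) = 0"
      using insert.IH[of "L - {p}" "\<lambda>e' l. a e' l - a e' p * a e l / a e p"] card insert.prems by auto
    define s where "s = (\<Sum>l\<in>L - {p}. a e l * c l)"
    \<comment> \<open>The value at the pivot \<open>p\<close> is the one that the equation
      \<open>e\<close> dictates.\<close>
    define d where "d = c(p := - s / a e p)"
    have split: "(\<Sum>l\<in>L. a e' l * d l) = - a e' p * s / a e p + (\<Sum>l\<in>L - {p}. a e' l * c l)" for e'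
    proof -
      have "(\<Sum>l\<in>L. a e' l * d l) = a e' p * d p + (\<Sum>l\<in>L - {p}. a e' l * d l)"
        using p insert.prems by (simp add: sum.remove)
      moreover have "(\<Sum>l\<in>L - {p}. a e' l * d l) = (\<Sum>l\<in>L - {p}. a e' l * c l)"
        by (intro sum.cong) (auto simp: d_def)
      ultimately show ?thesis by (simp add: d_def)
    qed
    have "(\<Sum>l\<in>L. a e' l * d l) = 0" if "e' \<in> insert e E" for e'
    proof (cases "e' = e")
      case True
      then show ?thesis unfolding split using p by (simp add: s_def)
    next
      case False
      then have "(\<Sum>l\<in>L - {p}. (a e' l - a e' p * a e l / a e p) * c l) = 0"
        using c that by auto
      moreover have "(\<Sum>l\<in>L - {p}. (a e' l - a e' p * a e l / a e p) * c l)
          = (\<Sum>l\<in>L - {p}. a e' l * c l) - a e' p / a e p * s"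
        unfolding s_def sum_distrib_left sum_subtractf[symmetric]
        by (intro sum.cong) (auto simp: algebra_simps)
      ultimately show ?thesis unfolding split by simp
    qed
    moreover have "\<exists>l\<in>L. d l \<noteq> 0" using c(1) by (auto simp: d_def)
    ultimately show ?thesis by blast
  qed
qed

text \<open>Subtracting a multiple of the linear dependence multiplies the \<open>l\<close>-th outer
  product by \<open>1 - c l / c l0\<close>. With \<open>c l0\<close> the largest coefficient, these
  weights are nonnegative and the one at \<open>l0\<close> vanishes; their square roots are absorbed
  into the vectors.\<close>

lemma cp_decomp_reduce:
  assumes dec: "cp_decomp n L v A"
    and nz: "\<exists>l\<in>L. c l \<noteq> 0"
    and dep: "\<And>i j. i < n \<Longrightarrow> j < n \<Longrightarrow> (\<Sum>l\<in>L. c l * (v l i * v l j)) = 0"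
  shows "\<exists>l0\<in>L. \<exists>w. cp_decomp n (L - {l0}) w A"
proof -
  have fin: "finite L" using dec by (rule cp_decompD)
  have aux: "\<exists>l0\<in>L. \<exists>w. cp_decomp n (L - {l0}) w A"
    if pos: "\<exists>l\<in>L. c l > 0" and dep: "\<And>i j. i < n \<Longrightarrow> j < n \<Longrightarrow> (\<Sum>l\<in>L. c l * (v l i * v l j)) = 0" for c
  proof -
    have "Max (c ` L) \<in> c ` L" using fin pos by (intro Max_in) auto
    then obtain l0 where l0: "l0 \<in> L" "c l0 = Max (c ` L)" by auto
    then have l0: "l0 \<in> L" "\<And>l. l \<in> L \<Longrightarrow> c l \<le> c l0" using fin by auto
    then have c0: "c l0 > 0" using pos by force
    define w where "w = (\<lambda>l i. sqrt (1 - c l / c l0) * v l i)"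
    have ge: "1 - c l / c l0 \<ge> 0" if "l \<in> L" for l
      using l0(2)[OF that] c0 by (simp add: field_simps)
    have "(\<Sum>l\<in>L - {l0}. w l i * w l j) = A i j" if "i < n" "j < n" for i j
    proof -
      have "(\<Sum>l\<in>L - {l0}. w l i * w l j) = (\<Sum>l\<in>L. w l i * w l j)"
        using fin l0 c0 by (simp add: sum.remove w_def)
      also have "\<dots> = (\<Sum>l\<in>L. v l i * v l j - (c l * (v l i * v l j)) / c l0)"
      proof (intro sum.cong refl)
        fix l assume l: "l \<in> L"
        have "w l i * w l j = (sqrt (1 - c l / c l0) * sqrt (1 - c l / c l0)) * (v l i * v l j)"
          by (simp add: w_def algebra_simps)
        also have "\<dots> = (1 - c l / c l0) * (v l i * v l j)" using ge[OF l] by simp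
        finally show "w l i * w l j = v l i * v l j - (c l * (v l i * v l j)) / c l0"
          by (simp add: algebra_simps)
      qed
      also have "\<dots> = A i j"
        using dep[OF that] cp_decompD(3)[OF dec that]
        by (simp add: sum_subtractf flip: sum_divide_distrib)
      finally show ?thesis .
    qed
    then have "cp_decomp n (L - {l0}) w A"
      using fin cp_decompD(2)[OF dec] ge by (auto simp: cp_decomp_def w_def)
    then show ?thesis using l0 by blast
  qed
  \<comment> \<open>The auxiliary fact needs a positive coefficient; if the chosen one is negative,
    the dependence is negated.\<close>
  obtain l where l: "l \<in> L" "c l \<noteq> 0" using nz by blast
  show ?thesis
  proof (cases "c l > 0")
    case True
    then show ?thesis using aux[of c] l dep by blast
  next
    case False
    then have "- c l > 0" using l by simp
    moreover have "(\<Sum>l\<in>L. (- c l) * (v l i * v l j)) = 0" if "i < n" "j < n" for i j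
      using dep[OF that] by (simp add: sum_negf)
    ultimately show ?thesis using aux[of "\<lambda>l. - c l"] l by blast
  qed
qed

text \<open>Caratheodory's theorem. \<open>E\<close> is a set of matrix positions that determine every matrix in the
  linear span of the rank-one matrices occurring in decompositions of \<open>A\<close>.\<close>

lemma cp_le_card_equations:
  assumes cp: "cp_le n k A" and fin: "finite E"
    and E: "\<And>L v c. cp_decomp n L v A \<Longrightarrow>
      (\<And>i j. (i, j) \<in> E \<Longrightarrow> (\<Sum>l\<in>L. c l * (v l i * v l j)) = 0) \<Longrightarrow>
      (\<And>i j. i < n \<Longrightarrow> j < n \<Longrightarrow> (\<Sum>l\<in>L. c l * (v l i * v l j)) = (0::real))"
  shows "cp_le n (card E) A"
proof -
  \<comment> \<open>A decomposition with the fewest vectors is taken. With more than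
    \<open>card E\<close> vectors, the equations at the positions in \<open>E\<close> would have a
    nontrivial solution, which is a dependence at all positions, and a vector could be
    dropped.\<close>
  define P where "P = (\<lambda>k. \<exists>L v. cp_decomp n L v A \<and> card L = k)"
  have "\<exists>k. P k" using cp by (auto simp: cp_le_def P_def)
  then have "P (LEAST k. P k)" by (metis LeastI)
  then obtain L v where Lv: "cp_decomp n L v A" "card L = (LEAST k. P k)" by (auto simp: P_def)
  have finL: "finite L" using Lv(1) by (rule cp_decompD)
  have "card L \<le> card E"
  proof (rule ccontr)
    assume "\<not> card L \<le> card E"
    then obtain c where c: "\<exists>l\<in>L. c l \<noteq> 0"
      "\<forall>e\<in>E. (\<Sum>l\<in>L. (v l (fst e) * v l (snd e)) * c l) = 0"
      using homogeneous_system_nontrivial[OF fin finL, of "\<lambda>e l. v l (fst e) * v l (snd e)"] by auto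
    have "(\<Sum>l\<in>L. c l * (v l i * v l j)) = 0" if "(i, j) \<in> E" for i j
      using c(2) that by (force simp: mult.commute)
    then have "(\<Sum>l\<in>L. c l * (v l i * v l j)) = 0" if "i < n" "j < n" for i j
      using E[OF Lv(1), of c] that by blast
    then obtain l0 w where "l0 \<in> L" "cp_decomp n (L - {l0}) w A"
      using cp_decomp_reduce[OF Lv(1) c(1)] by blast
    then have "P (card (L - {l0}))" "card (L - {l0}) < card L"
      using finL by (auto simp: P_def card_gt_0_iff intro: diff_less)
    then show False using Lv(2) by (metis not_less_Least)
  qed
  then show ?thesis using Lv(1) by (auto simp: cp_le_def)
qed

text \<open>With \<open>w l\<close> the defect of the relation in the vector \<open>v l\<close>, the
  relation between the rows of \<open>A\<close> says that the sum of \<open>w l * v l m\<close>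
  vanishes for every \<open>m\<close>. Combining these sums gives that the squares of the
  \<open>w l\<close> add up to 0.\<close>

lemma cp_decomp_row_relation:
  assumes dec: "cp_decomp n L v A" and i: "i < n" and J: "J \<subseteq> {..<n}"
    and rel: "\<And>m. m < n \<Longrightarrow> A i m = (\<Sum>j\<in>J. a j * A j m)" and l: "l \<in> L"
  shows "v l i = (\<Sum>j\<in>J. a j * v l j)"
proof -
  define w where "w = (\<lambda>l. v l i - (\<Sum>j\<in>J. a j * v l j))"
  have wv: "(\<Sum>l\<in>L. w l * v l m) = 0" if m: "m < n" for m
  proof -
    have "(\<Sum>l\<in>L. w l * v l m) = (\<Sum>l\<in>L. v l i * v l m) - (\<Sum>l\<in>L. \<Sum>j\<in>J. a j * (v l j * v l m))"
      by (simp add: w_def left_diff_distrib sum_subtractf sum_distrib_right mult.assoc)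
    also have "(\<Sum>l\<in>L. \<Sum>j\<in>J. a j * (v l j * v l m)) = (\<Sum>j\<in>J. a j * (\<Sum>l\<in>L. v l j * v l m))"
      by (subst sum.swap) (simp add: sum_distrib_left)
    also have "\<dots> = (\<Sum>j\<in>J. a j * A j m)"
      using J m by (intro sum.cong) (auto simp: cp_decompD(3)[OF dec])
    finally show ?thesis using rel[OF m] cp_decompD(3)[OF dec i m] by simp
  qed
  have "(\<Sum>l\<in>L. w l * w l) = (\<Sum>l\<in>L. w l * v l i) - (\<Sum>l\<in>L. \<Sum>j\<in>J. a j * (w l * v l j))"
    by (subst (2) w_def) (simp add: algebra_simps sum_subtractf sum_distrib_left)
  also have "(\<Sum>l\<in>L. \<Sum>j\<in>J. a j * (w l * v l j)) = (\<Sum>j\<in>J. a j * (\<Sum>l\<in>L. w l * v l j))"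
    by (subst sum.swap) (simp add: sum_distrib_left)
  also have "\<dots> = 0" using J wv by (intro sum.neutral) auto
  finally have "(\<Sum>l\<in>L. w l * w l) = 0" using wv[OF i] by simp
  then have "w l = 0"
    using cp_decompD(1)[OF dec] l by (subst (asm) sum_nonneg_eq_0_iff) auto
  then show ?thesis by (simp add: w_def)
qed

lemma card_ordered_pairs:
  assumes "finite (J :: nat set)"
  shows "card {(i, j). i \<in> J \<and> j \<in> J \<and> i \<le> j} = card J * (card J + 1) div 2"
  using assms
proof (induction J rule: finite_linorder_max_induct)
  case (insert b A)
  have triangular: "k * (k + 1) div 2 + (k + 1) = (k + 1) * (k + 2) div 2" for k :: nat
  proof -
    have "(k + 1) * (k + 2) = k * (k + 1) + (k + 1) * 2" by (simp add: algebra_simps)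
    then show ?thesis by (simp only: div_mult_self1 zero_neq_numeral not_False_eq_True add.commute)
  qed
  have eq: "{(i, j). i \<in> insert b A \<and> j \<in> insert b A \<and> i \<le> j} =
    {(i, j). i \<in> A \<and> j \<in> A \<and> i \<le> j} \<union> (\<lambda>i. (i, b)) ` insert b A"
    using insert.hyps by force
  have fin: "finite {(i, j). i \<in> A \<and> j \<in> A \<and> i \<le> j}"
    using insert.hyps by (auto intro: finite_subset[of _ "A \<times> A"])
  have b: "b \<notin> A" using insert.hyps by auto
  have "card ((\<lambda>i. (i, b)) ` insert b A) = card A + 1"
    using insert.hyps b by (subst card_image) (auto simp: inj_on_def)
  moreover have "{(i, j). i \<in> A \<and> j \<in> A \<and> i \<le> j} \<inter> (\<lambda>i. (i, b)) ` insert b A = {}"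
    using b by auto
  ultimately have "card ({(i, j). i \<in> A \<and> j \<in> A \<and> i \<le> j} \<union> (\<lambda>i. (i, b)) ` insert b A)
      = card A * (card A + 1) div 2 + (card A + 1)"
    using card_Un_disjoint[OF fin, of "(\<lambda>i. (i, b)) ` insert b A"] insert.IH insert.hyps(1)
    by (metis finite_imageI finite_insert)
  moreover have "card (insert b A) = card A + 1" using insert.hyps(1) b by simp
  ultimately show ?case unfolding eq using triangular[of "card A"] by simp
qed simp

text \<open>The relations between the rows pass to every vector of a decomposition, so an outer
  product is determined by its entries at positions in \<open>J\<close>; by symmetry those with
  \<open>i \<le> j\<close> suffice.\<close>

lemma cp_le_spanning_rows:
  assumes cp: "cp_le n k A" and J: "J \<subseteq> {..<n}"
    and rel: "\<And>i. i < n \<Longrightarrow> \<exists>a. \<forall>m<n. A i m = (\<Sum>j\<in>J. a j * A j m)"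
  shows "cp_le n (card J * (card J + 1) div 2) A"
proof -
  define E where "E = {(i, j). i \<in> J \<and> j \<in> J \<and> i \<le> j}"
  have finJ: "finite J" using J finite_subset by blast
  then have finE: "finite E" unfolding E_def by (auto intro: finite_subset[of _ "J \<times> J"])
  obtain a where a: "\<And>i m. i < n \<Longrightarrow> m < n \<Longrightarrow> A i m = (\<Sum>j\<in>J. a i j * A j m)"
    using rel by metis
  have "cp_le n (card E) A"
  proof (rule cp_le_card_equations[OF cp finE])
    fix L v c i j
    assume dec: "cp_decomp n L v A" and ij: "i < n" "j < n"
      and e: "\<And>i j. (i, j) \<in> E \<Longrightarrow> (\<Sum>l\<in>L. c l * (v l i * v l j)) = (0::real)"
    have e': "(\<Sum>l\<in>L. c l * (v l p * v l q)) = 0" if "p \<in> J" "q \<in> J" for p q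
      using e[of p q] e[of q p] that by (cases "p \<le> q") (auto simp: E_def mult.commute)
    have v: "v l i = (\<Sum>j\<in>J. a i j * v l j)" if "i < n" "l \<in> L" for i l
      using cp_decomp_row_relation[OF dec that(1) J a[OF that(1)] that(2)] .
    have "(\<Sum>l\<in>L. c l * (v l i * v l j)) =
        (\<Sum>l\<in>L. \<Sum>p\<in>J. \<Sum>q\<in>J. a i p * a j q * (c l * (v l p * v l q)))"
      using ij by (intro sum.cong refl)
        (simp add: v sum_product, simp add: sum_distrib_left algebra_simps)
    also have "\<dots> = (\<Sum>p\<in>J. \<Sum>l\<in>L. \<Sum>q\<in>J. a i p * a j q * (c l * (v l p * v l q)))"
      by (rule sum.swap)
    also have "\<dots> = (\<Sum>p\<in>J. \<Sum>q\<in>J. \<Sum>l\<in>L. a i p * a j q * (c l * (v l p * v l q)))"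
      by (rule sum.cong[OF refl]) (rule sum.swap)
    also have "\<dots> = (\<Sum>p\<in>J. \<Sum>q\<in>J. a i p * a j q * (\<Sum>l\<in>L. c l * (v l p * v l q)))"
      by (simp add: sum_distrib_left)
    also have "\<dots> = 0" by (simp add: e')
    finally show "(\<Sum>l\<in>L. c l * (v l i * v l j)) = 0" .
  qed
  then show ?thesis using card_ordered_pairs[OF finJ] by (simp add: E_def)
qed

lemma sum_delta_mult:
  fixes f :: "'i \<Rightarrow> 'a::semiring_1"
  assumes "finite I" "i \<in> I"
  shows "(\<Sum>j\<in>I. (if j = i then 1 else 0) * f j) = f i"
proof -
  have "(\<Sum>j\<in>I. (if j = i then 1 else 0) * f j) = (\<Sum>j\<in>I. if j = i then f j else 0)"
    by (intro sum.cong) auto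
  then show ?thesis using assms by simp
qed

lemma cp_le_binomial:
  assumes "cp_le n k A"
  shows "cp_le n (n * (n + 1) div 2) A"
proof -
  have "\<exists>a. \<forall>m<n. A i m = (\<Sum>j<n. a j * A j m)" if "i < n" for i
    using that by (intro exI[of _ "\<lambda>j. if j = i then 1 else 0"]) (simp add: sum_delta_mult)
  then show ?thesis using cp_le_spanning_rows[OF assms, of "{..<n}"] by auto
qed

text \<open>A kernel vector that is nonzero at \<open>p\<close> expresses row \<open>p\<close>
  through the \<open>n - 1\<close> other rows.\<close>

lemma cp_le_singular:
  assumes cp: "cp_le n k A" and p: "p < n" "x p \<noteq> 0"
    and ker: "\<And>m. m < n \<Longrightarrow> (\<Sum>j<n. x j * A j m) = 0"
  shows "cp_le n (n * (n - 1) div 2) A"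
proof -
  have "\<exists>a. \<forall>m<n. A i m = (\<Sum>j\<in>{..<n} - {p}. a j * A j m)" if i: "i < n" for i
  proof (cases "i = p")
    case True
    have "A p m = (\<Sum>j\<in>{..<n} - {p}. (- x j / x p) * A j m)" if "m < n" for m
    proof -
      have "x p * A p m + (\<Sum>j\<in>{..<n} - {p}. x j * A j m) = 0"
        using ker[OF that] p by (simp add: sum.remove[of _ p])
      then have "A p m = - (\<Sum>j\<in>{..<n} - {p}. x j * A j m) / x p"
        using p by (simp add: field_simps eq_neg_iff_add_eq_0)
      also have "\<dots> = (\<Sum>j\<in>{..<n} - {p}. (- x j / x p) * A j m)"
        by (simp add: sum_divide_distrib sum_negf)
      finally show ?thesis .
    qed
    then have "\<forall>m<n. A i m = (\<Sum>j\<in>{..<n} - {p}. (- x j / x p) * A j m)"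
      unfolding True by simp
    then show ?thesis by (intro exI[of _ "\<lambda>j. - x j / x p"])
  next
    case False
    then have "i \<in> {..<n} - {p}" using i by simp
    then show ?thesis
      by (intro exI[of _ "\<lambda>j. if j = i then 1 else 0"]) (simp add: sum_delta_mult)
  qed
  then have "cp_le n (card ({..<n} - {p}) * (card ({..<n} - {p}) + 1) div 2) A"
    using cp_le_spanning_rows[OF cp, of "{..<n} - {p}"] by blast
  then show ?thesis using p by (simp add: mult.commute)
qed

section \<open>Copositive forms and their zeros\<close>

definition bilin :: "nat \<Rightarrow> (nat \<Rightarrow> nat \<Rightarrow> real) \<Rightarrow> (nat \<Rightarrow> real) \<Rightarrow> (nat \<Rightarrow> real) \<Rightarrow> real" where
  "bilin n S x y = (\<Sum>i<n. x i * (\<Sum>j<n. S i j * y j))"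

definition symmetric :: "nat \<Rightarrow> (nat \<Rightarrow> nat \<Rightarrow> real) \<Rightarrow> bool" where
  "symmetric n S \<longleftrightarrow> (\<forall>i<n. \<forall>j<n. S i j = S j i)"

definition copositive :: "nat \<Rightarrow> (nat \<Rightarrow> nat \<Rightarrow> real) \<Rightarrow> bool" where
  "copositive n S \<longleftrightarrow> (\<forall>x. (\<forall>i<n. 0 \<le> x i) \<longrightarrow> 0 \<le> bilin n S x x)"

lemma copositiveD:
  assumes "copositive n S" "\<And>i. i < n \<Longrightarrow> 0 \<le> x i"
  shows "0 \<le> bilin n S x x"
  using assms unfolding copositive_def by blast

lemma bilin_add_left: "bilin n S (\<lambda>i. x i + t * y i) z = bilin n S x z + t * bilin n S y z"
  by (simp add: bilin_def distrib_right sum.distrib sum_distrib_left mult.assoc)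

lemma bilin_commute:
  assumes "symmetric n S"
  shows "bilin n S x y = bilin n S y x"
proof -
  have "bilin n S x y = (\<Sum>i<n. \<Sum>j<n. x i * (S i j * y j))"
    by (simp add: bilin_def sum_distrib_left)
  also have "\<dots> = (\<Sum>j<n. \<Sum>i<n. x i * (S i j * y j))" by (rule sum.swap)
  also have "\<dots> = (\<Sum>j<n. \<Sum>i<n. y j * (S j i * x i))"
    using assms by (intro sum.cong refl) (simp add: symmetric_def)
  finally show ?thesis by (simp add: bilin_def sum_distrib_left)
qed

lemma bilin_add_self:
  assumes "symmetric n S"
  shows "bilin n S (\<lambda>i. x i + t * y i) (\<lambda>i. x i + t * y i)
    = bilin n S x x + 2 * t * bilin n S x y + t\<^sup>2 * bilin n S y y"
proof -
  have "bilin n S (\<lambda>i. x i + t * y i) (\<lambda>i. x i + t * y i)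
      = bilin n S x (\<lambda>i. x i + t * y i) + t * bilin n S y (\<lambda>i. x i + t * y i)"
    by (rule bilin_add_left)
  also have "\<dots> = bilin n S (\<lambda>i. x i + t * y i) x + t * bilin n S (\<lambda>i. x i + t * y i) y"
    by (simp add: bilin_commute[OF assms])
  also have "\<dots> = bilin n S x x + t * bilin n S y x + t * (bilin n S x y + t * bilin n S y y)"
    by (simp add: bilin_add_left)
  finally show ?thesis
    by (simp add: bilin_commute[OF assms, of y x] power2_eq_square algebra_simps)
qed

lemma bilin_unit:
  assumes "i < n"
  shows "bilin n S (\<lambda>k. if k = i then 1 else 0) y = (\<Sum>j<n. S i j * y j)"
  unfolding bilin_def using assms by (intro sum_delta_mult) auto

lemma bilin_unit_unit:
  assumes "i < n" "j < n"
  shows "bilin n S (\<lambda>k. if k = i then 1 else 0) (\<lambda>k. if k = j then 1 else 0) = S i j"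
proof -
  have "(\<Sum>k<n. S i k * (if k = j then 1 else 0)) = S i j"
    using assms sum_delta_mult[of "{..<n}" j "S i"] by (simp add: mult.commute)
  then show ?thesis using bilin_unit[OF assms(1)] by simp
qed

text \<open>The first-order condition at the end point 0 of an interval: for small \<open>t\<close>
  the linear term dominates.\<close>

lemma linear_coeff_nonneg:
  fixes b c :: real
  assumes "\<And>t. 0 < t \<Longrightarrow> t \<le> 1 \<Longrightarrow> 0 \<le> 2 * t * b + t\<^sup>2 * c"
  shows "0 \<le> b"
proof (rule ccontr)
  assume b: "\<not> 0 \<le> b"
  \<comment> \<open>The term with \<open>c\<close> keeps \<open>t * c\<close> at most
    \<open>- b\<close>, so that \<open>2 * b + t * c\<close> is at most \<open>b\<close>; the term
    with \<open>b\<close> keeps \<open>t\<close> at most 1.\<close>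
  define t where "t = - b / (\<bar>c\<bar> + \<bar>b\<bar> + 1)"
  have t: "0 < t" "t \<le> 1" using b unfolding t_def by (simp add: divide_neg_pos, subst pos_divide_le_eq) auto
  have "t * c \<le> t * (\<bar>c\<bar> + \<bar>b\<bar> + 1)" using t by (intro mult_left_mono) auto
  also have "\<dots> = - b" using b by (simp add: t_def)
  finally have "2 * b + t * c < 0" using b by linarith
  then have "t * (2 * b + t * c) < 0" using t by (simp add: mult_pos_neg)
  then show False using assms[OF t] by (simp add: power2_eq_square algebra_simps)
qed

text \<open>A zero minimizes the form over the nonnegative orthant, so the derivative in each
  direction \<open>e_i\<close> is nonnegative. The products \<open>z i * (S z) i\<close> are then
  nonnegative and add up to the value 0 of the form.\<close>

lemma copositive_zero_gradient:
  assumes sym: "symmetric n S" and cop: "copositive n S"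
    and z: "\<And>i. i < n \<Longrightarrow> 0 \<le> z i" "bilin n S z z = 0" and i: "i < n"
  shows "0 \<le> (\<Sum>j<n. S i j * z j)" "z i * (\<Sum>j<n. S i j * z j) = 0"
proof -
  have ge: "0 \<le> (\<Sum>j<n. S i j * z j)" if i: "i < n" for i
  proof -
    let ?e = "\<lambda>k. if k = i then 1 else 0"
    have "0 \<le> 2 * t * bilin n S z ?e + t\<^sup>2 * bilin n S ?e ?e" if "0 < t" "t \<le> 1" for t
    proof -
      have "0 \<le> bilin n S (\<lambda>k. z k + t * ?e k) (\<lambda>k. z k + t * ?e k)"
        using z(1) that by (intro copositiveD[OF cop]) simp
      then show ?thesis using z(2) by (simp add: bilin_add_self[OF sym])
    qed
    then have "0 \<le> bilin n S z ?e" by (rule linear_coeff_nonneg)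
    then show ?thesis using bilin_unit[OF i] by (simp add: bilin_commute[OF sym, of z])
  qed
  then show "0 \<le> (\<Sum>j<n. S i j * z j)" using i .
  have "\<forall>i\<in>{..<n}. z i * (\<Sum>j<n. S i j * z j) = 0"
    using z(2) unfolding bilin_def
    by (subst (asm) sum_nonneg_eq_0_iff) (auto simp: z(1) ge)
  then show "z i * (\<Sum>j<n. S i j * z j) = 0" using i by simp
qed

lemma exists_small_perturbation:
  fixes z x :: "'i \<Rightarrow> real"
  assumes "finite I" "\<And>i. i \<in> I \<Longrightarrow> z i > 0"
  shows "\<exists>t>0. \<forall>i\<in>I. \<forall>s. 0 \<le> s \<and> s \<le> t \<longrightarrow> 0 \<le> z i + s * x i"
  using assms
proof (induction I rule: finite_induct)
  case empty
  then show ?case by (intro exI[of _ 1]) auto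
next
  case (insert i I)
  then obtain t where t: "t > 0" "\<And>j s. j \<in> I \<Longrightarrow> 0 \<le> s \<Longrightarrow> s \<le> t \<Longrightarrow> 0 \<le> z j + s * x j" by auto
  define u where "u = z i / (\<bar>x i\<bar> + 1)"
  have u: "u > 0" using insert.prems by (simp add: u_def)
  have "0 \<le> z i + s * x i" if "0 \<le> s" "s \<le> u" for s
  proof -
    have "s * (- x i) \<le> s * (\<bar>x i\<bar> + 1)" using that by (intro mult_left_mono) auto
    also have "\<dots> \<le> u * (\<bar>x i\<bar> + 1)" using that by (intro mult_right_mono) auto
    also have "\<dots> = z i" by (simp add: u_def)
    finally show ?thesis by simp
  qed
  then show ?case using t u by (intro exI[of _ "min t u"]) auto
qed

text \<open>Thus \<open>P\<close> is exactly the set of nonzero rows, and the form depends only on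
  the coordinates in \<open>P\<close>. Supports of zeros are therefore taken within
  \<open>P\<close>.\<close>

locale copositive_form =
  fixes n :: nat and S :: "nat \<Rightarrow> nat \<Rightarrow> real" and P :: "nat set"
  assumes sym: "symmetric n S" and cop: "copositive n S"
    and P_subset: "P \<subseteq> {..<n}"
    and diag_pos: "\<And>i. i \<in> P \<Longrightarrow> S i i > 0"
    and row_zero: "\<And>i j. i < n \<Longrightarrow> j < n \<Longrightarrow> i \<notin> P \<Longrightarrow> S i j = 0"
begin

text \<open>Half the gradient of the quadratic form at \<open>z\<close>.\<close>

definition grad :: "(nat \<Rightarrow> real) \<Rightarrow> nat \<Rightarrow> real" where
  "grad z i = (\<Sum>j<n. S i j * z j)"

definition zero_vec :: "(nat \<Rightarrow> real) \<Rightarrow> bool" where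
  "zero_vec z \<longleftrightarrow> (\<forall>i<n. 0 \<le> z i) \<and> bilin n S z z = 0"

definition supp :: "(nat \<Rightarrow> real) \<Rightarrow> nat set" where
  "supp z = {i \<in> P. z i > 0}"

lemma finite_P: "finite P"
  using P_subset finite_subset by blast

lemma col_zero: "i < n \<Longrightarrow> j < n \<Longrightarrow> j \<notin> P \<Longrightarrow> S i j = 0"
  using row_zero[of j i] sym by (simp add: symmetric_def)

lemma bilin_grad: "bilin n S y z = (\<Sum>i<n. y i * grad z i)"
  by (simp add: bilin_def grad_def)

lemma grad_outside: "i < n \<Longrightarrow> i \<notin> P \<Longrightarrow> grad z i = 0"
  by (simp add: grad_def row_zero)

lemma copositive_on_P:
  assumes "\<And>i. i \<in> P \<Longrightarrow> 0 \<le> x i"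
  shows "0 \<le> bilin n S x x"
proof -
  define y where "y = (\<lambda>i. if i \<in> P then x i else 0)"
  have "S i j * x j = S i j * y j" if "i < n" "j < n" for i j
    using that by (simp add: y_def col_zero)
  then have g: "grad x i = grad y i" if "i < n" for i
    using that unfolding grad_def by (intro sum.cong) auto
  have "bilin n S x x = bilin n S y y"
    unfolding bilin_grad using grad_outside g by (intro sum.cong) (auto simp: y_def)
  moreover have "0 \<le> bilin n S y y"
    using assms by (intro copositiveD[OF cop]) (simp add: y_def)
  ultimately show ?thesis by simp
qed

lemma zero_vec_grad:
  assumes "zero_vec z" "i < n"
  shows "0 \<le> grad z i" "z i * grad z i = 0"
  using copositive_zero_gradient[OF sym cop, of z i] assms by (auto simp: zero_vec_def grad_def)

lemma zero_vec_grad_supp: "zero_vec z \<Longrightarrow> i \<in> supp z \<Longrightarrow> grad z i = 0"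
  using zero_vec_grad[of z i] P_subset by (auto simp: supp_def)

lemma grad_eq_sum_supp:
  assumes "zero_vec z" "i < n"
  shows "grad z i = (\<Sum>j\<in>supp z. S i j * z j)"
  unfolding grad_def
proof (rule sum.mono_neutral_right)
  show "supp z \<subseteq> {..<n}" using P_subset by (auto simp: supp_def)
  show "\<forall>j\<in>{..<n} - supp z. S i j * z j = 0"
  proof
    fix j assume j: "j \<in> {..<n} - supp z"
    then have "j \<notin> P \<or> z j = 0" using assms(1) by (auto simp: supp_def zero_vec_def not_less intro: antisym)
    then show "S i j * z j = 0" using col_zero[OF assms(2), of j] j by auto
  qed
qed simp

text \<open>The gradient vanishes on all of \<open>P\<close>, so the form at \<open>z + t x\<close>
  is \<open>t\<^sup>2\<close> times its value at \<open>x\<close>. If \<open>x q\<close> is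
  nonnegative, \<open>z + t x\<close> is nonnegative on \<open>P\<close> for small
  \<open>t > 0\<close>; otherwise \<open>- x\<close> is used.\<close>

lemma psd_if_large_zero:
  assumes z: "zero_vec z" and q: "q \<in> P" "grad z q = 0" and supp: "P - {q} \<subseteq> supp z"
  shows "0 \<le> bilin n S x x"
proof -
  have aux: "0 \<le> bilin n S x x" if x: "0 \<le> x q" for x
  proof -
    have "finite (P - {q})" using finite_P by simp
    then obtain t where t: "t > 0" "\<forall>i\<in>P - {q}. \<forall>s. 0 \<le> s \<and> s \<le> t \<longrightarrow> 0 \<le> z i + s * x i"
      using exists_small_perturbation[of "P - {q}" z x] supp by (auto simp: supp_def subset_iff)
    have "z q \<ge> 0" using z q(1) P_subset by (auto simp: zero_vec_def)
    then have "0 \<le> z i + t * x i" if "i \<in> P" for i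
      using that t x by (cases "i = q") auto
    then have "0 \<le> bilin n S (\<lambda>i. z i + t * x i) (\<lambda>i. z i + t * x i)"
      by (rule copositive_on_P)
    moreover have "grad z i = 0" if "i < n" for i
      using zero_vec_grad_supp[OF z] supp q(2) grad_outside[OF that] by (cases "i \<in> P") auto
    then have "bilin n S x z = 0" by (simp add: bilin_grad)
    ultimately have "0 \<le> t\<^sup>2 * bilin n S x x"
      using z by (simp add: bilin_add_self[OF sym] bilin_commute[OF sym, of z x] zero_vec_def)
    then show ?thesis using t(1) by (simp add: zero_le_mult_iff)
  qed
  have neg: "bilin n S (\<lambda>i. - x i) (\<lambda>i. - x i) = bilin n S x x"
    by (simp add: bilin_def sum_negf)
  show ?thesis
    using aux[of x] aux[of "\<lambda>i. - x i"] unfolding neg by force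
qed

text \<open>The combination \<open>b + s (k c - a)\<close>, with \<open>k\<close> chosen to cancel the entry at \<open>p\<close>, is nonnegative
  for small \<open>s > 0\<close>, and the form takes the value \<open>- 2 s\<^sup>2 k (grad a q) (c q)\<close> there.\<close>

lemma psd_if_two_large_zeros:
  assumes a: "zero_vec a" "supp a = P - {q}" and b: "zero_vec b" "supp b = P - {p}"
    and c: "zero_vec c" "p \<in> supp c" "q \<in> supp c" and pq: "p \<noteq> q"
  shows "0 \<le> bilin n S x x"
proof (rule ccontr)
  assume not_psd: "\<not> 0 \<le> bilin n S x x"
  have P: "p \<in> P" "q \<in> P" and cpos: "c p > 0" "c q > 0" using c by (auto simp: supp_def)
  \<comment> \<open>If this gradient entry vanished, \<open>a\<close> alone would make the form
    positive semidefinite.\<close>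
  have "grad a q \<noteq> 0" using psd_if_large_zero[OF a(1) P(2)] a(2) not_psd by auto
  then have alpha: "grad a q > 0" using zero_vec_grad[OF a(1), of q] P P_subset by force
  have ap: "a p > 0" using a(2) P pq by (auto simp: supp_def)
  define k where "k = a p / c p"
  have k: "k > 0" "k * c p = a p" using ap cpos by (auto simp: k_def)
  define d where "d = (\<lambda>i. (- a i) + k * c i)"
  have ga: "grad a i = 0" if "i < n" "i \<noteq> q" for i
    using zero_vec_grad_supp[OF a(1), of i] grad_outside[OF that(1)] a(2) that by (cases "i \<in> P") auto
  have gb: "grad b i = 0" if "i < n" "i \<noteq> p" for i
    using zero_vec_grad_supp[OF b(1), of i] grad_outside[OF that(1)] b(2) that by (cases "i \<in> P") auto
  \<comment> \<open>The gradient of \<open>a\<close> lives at \<open>q\<close> alone and that of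
    \<open>b\<close> at \<open>p\<close> alone, so pairing with \<open>a\<close> or \<open>b\<close>
    reads off a single coordinate.\<close>
  have ya: "bilin n S y a = y q * grad a q" for y
    unfolding bilin_grad using P P_subset ga
    by (subst sum.mono_neutral_right[of "{..<n}" "{q}"]) auto
  have yb: "bilin n S y b = y p * grad b p" for y
    unfolding bilin_grad using P P_subset gb
    by (subst sum.mono_neutral_right[of "{..<n}" "{p}"]) auto
  \<comment> \<open>By the choice of \<open>k\<close>, the direction \<open>d\<close> vanishes at
    \<open>p\<close>. Hence the form at \<open>b + t d\<close> has no linear term, and the zero
    coordinate \<open>b p\<close> is left unchanged.\<close>
  have db: "bilin n S b d = 0"
    using k by (simp add: bilin_commute[OF sym, of b] yb d_def)
  have neg: "bilin n S (\<lambda>i. - a i) y = - bilin n S a y" for y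
    by (simp add: bilin_def sum_negf)
  have "bilin n S (\<lambda>i. - a i) (\<lambda>i. - a i) = 0"
    using a(1) by (simp add: bilin_def sum_negf zero_vec_def)
  moreover have "bilin n S (\<lambda>i. - a i) c = - c q * grad a q"
    using ya[of c] by (simp add: neg bilin_commute[OF sym, of a])
  ultimately have "bilin n S d d = - 2 * k * c q * grad a q"
    using c(1) bilin_add_self[OF sym, of "\<lambda>i. - a i" k c] unfolding d_def zero_vec_def by simp
  then have dd: "bilin n S d d < 0" using k cpos alpha by simp
  have "finite (P - {p})" using finite_P by simp
  then obtain t where t: "t > 0" "\<forall>i\<in>P - {p}. \<forall>s. 0 \<le> s \<and> s \<le> t \<longrightarrow> 0 \<le> b i + s * d i"
    using exists_small_perturbation[of "P - {p}" b d] b(2) by (auto simp: supp_def)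
  have "0 \<le> b i + t * d i" if "i \<in> P" for i
  proof (cases "i = p")
    case True
    have "d p = 0" using k by (simp add: d_def)
    then show ?thesis using True b(1) P P_subset by (auto simp: zero_vec_def)
  next
    case False
    then show ?thesis using t that by auto
  qed
  then have "0 \<le> bilin n S (\<lambda>i. b i + t * d i) (\<lambda>i. b i + t * d i)"
    by (rule copositive_on_P)
  also have "\<dots> = t\<^sup>2 * bilin n S d d"
    using b(1) db by (simp add: bilin_add_self[OF sym] zero_vec_def)
  finally show False using dd t(1) by (simp add: zero_le_mult_iff)
qed

text \<open>The bound 4 is sharp: the zeros of the Horn form of order 5 cover all pairs of indices.\<close>

lemma psd_if_zeros_cover_pairs:
  assumes card: "card P \<le> 4"
    and cover: "\<And>i j. i \<in> P \<Longrightarrow> j \<in> P \<Longrightarrow> \<exists>z. zero_vec z \<and> i \<in> supp z \<and> j \<in> supp z"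
  shows "0 \<le> bilin n S x x"
proof (rule ccontr)
  assume not_psd: "\<not> 0 \<le> bilin n S x x"
  have supp_P: "supp z \<subseteq> P" for z by (auto simp: supp_def)
  have Pn: "i < n" if "i \<in> P" for i using that P_subset by auto
  have fin: "finite (supp z)" for z using supp_P finite_P finite_subset by blast
  have "P \<noteq> {}"
  proof
    assume "P = {}"
    then have "bilin n S x x = 0" by (simp add: bilin_grad grad_outside)
    then show False using not_psd by simp
  qed
  \<comment> \<open>A zero positive on all of \<open>P\<close> would make the form positive
    semidefinite.\<close>
  then have notfull: "supp z \<noteq> P" if "zero_vec z" for z
    using that psd_if_large_zero[OF that] zero_vec_grad_supp[OF that] not_psd by blast
  show False
  \<comment> \<open>If some support misses exactly one index \<open>q\<close>, a second zero missing
    exactly one index \<open>p\<close> different from \<open>q\<close> will be found. Otherwise all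
    supports have at most two elements, and the signs of the off-diagonal entries give the
    contradiction.\<close>
  proof (cases "\<exists>a q. zero_vec a \<and> q \<in> P \<and> supp a = P - {q}")
    case True
    then obtain a q where a: "zero_vec a" "q \<in> P" "supp a = P - {q}" by blast
    have "grad a q \<noteq> 0" using psd_if_large_zero[OF a(1,2)] a(3) not_psd by auto
    then have "0 < grad a q" using zero_vec_grad[OF a(1), of q] Pn[OF a(2)] by simp
    \<comment> \<open>The positive gradient of \<open>a\<close> at \<open>q\<close> needs a positive
      off-diagonal entry \<open>S q i\<close>.\<close>
    then have "\<exists>i\<in>supp a. 0 < S q i * a i"
      unfolding grad_eq_sum_supp[OF a(1) Pn[OF a(2)]] by (meson not_less sum_nonpos)
    then obtain i where i: "i \<in> supp a" "0 < S q i * a i" by blast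
    then have Sqi: "S q i > 0" by (auto simp: supp_def zero_less_mult_iff)
    have iP: "i \<in> P" "i \<noteq> q" using i(1) a(3) by auto
    obtain b where b: "zero_vec b" "i \<in> supp b" "q \<in> supp b" using cover[OF iP(1) a(2)] by blast
    \<comment> \<open>With only \<open>q\<close> and \<open>i\<close> in its support,
      \<open>b\<close> would have a positive gradient at \<open>q\<close>. So its support has at
      least three of the at most four indices, but not all of them.\<close>
    have "supp b \<noteq> {q, i}"
    proof
      assume "supp b = {q, i}"
      then have "grad b q = S q q * b q + S q i * b i"
        using grad_eq_sum_supp[OF b(1) Pn[OF a(2)]] iP by simp
      moreover have "0 < S q q * b q" "0 < S q i * b i"
        using b diag_pos[OF a(2)] Sqi by (auto simp: supp_def)
      ultimately show False using zero_vec_grad_supp[OF b(1,3)] by simp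
    qed
    then obtain r where r: "r \<in> supp b" "r \<noteq> q" "r \<noteq> i" using b by blast
    have "{q, i, r} \<subseteq> supp b" using b r by simp
    then have "card {q, i, r} \<le> card (supp b)" by (rule card_mono[OF fin])
    then have c3: "3 \<le> card (supp b)" using iP r by simp
    have "supp b \<subset> P" using supp_P notfull[OF b(1)] by blast
    then obtain p where p: "p \<in> P" "p \<notin> supp b" by blast
    have "supp b = P - {p}"
    proof (rule card_subset_eq)
      show "finite (P - {p})" using finite_P by simp
      show s: "supp b \<subseteq> P - {p}" using p supp_P by blast
      have "card (supp b) \<le> card (P - {p})" by (rule card_mono[OF _ s]) (simp add: finite_P)
      moreover have "card (P - {p}) \<le> 3" using card p finite_P by simp
      ultimately show "card (supp b) = card (P - {p})" using c3 by linarith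
    qed
    moreover obtain c where "zero_vec c" "p \<in> supp c" "q \<in> supp c" using cover[OF p(1) a(2)] by blast
    moreover have "p \<noteq> q" using b p by blast
    ultimately show False using psd_if_two_large_zeros[OF a(1,3) b(1)] not_psd by blast
  next
    case False
    have small: "card (supp z) + 2 \<le> card P" if z: "zero_vec z" for z
    proof -
      have "supp z \<subset> P" using supp_P notfull[OF z] by blast
      then obtain p where p: "p \<in> P" "p \<notin> supp z" by blast
      then have "supp z \<subset> P - {p}" using False z supp_P by blast
      then have "card (supp z) < card (P - {p})" using finite_P by (intro psubset_card_mono) auto
      then show ?thesis using p finite_P by (simp add: card_gt_0_iff)
    qed
    have supp2: "supp z = {i, j}" if "zero_vec z" "i \<in> supp z" "j \<in> supp z" "i \<noteq> j" for z i j
    proof -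
      have "{i, j} \<subseteq> supp z" "card {i, j} = 2" "card (supp z) \<le> 2"
        using that small[OF that(1)] card by auto
      then show ?thesis using card_seteq[OF fin] by metis
    qed
    \<comment> \<open>The zero covering \<open>i\<close> and \<open>j\<close> has no further
      support, so the vanishing gradient at \<open>i\<close> balances the positive diagonal term
      against \<open>S i j\<close>.\<close>
    have negS: "S i j < 0" if ij: "i \<in> P" "j \<in> P" "i \<noteq> j" for i j
    proof -
      obtain z where z: "zero_vec z" "i \<in> supp z" "j \<in> supp z" using cover[OF ij(1,2)] by blast
      have "S i i * z i + S i j * z j = 0"
        using grad_eq_sum_supp[OF z(1) Pn[OF ij(1)]] zero_vec_grad_supp[OF z(1,2)]
          supp2[OF z ij(3)] ij(3) by simp
      moreover have "0 < S i i * z i" using z diag_pos[OF ij(1)] by (auto simp: supp_def)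
      ultimately have "S i j * z j < 0" by linarith
      then show ?thesis using z(3) by (auto simp: supp_def mult_less_0_iff)
    qed
    obtain i where i: "i \<in> P" using \<open>P \<noteq> {}\<close> by blast
    obtain z where z: "zero_vec z" "i \<in> supp z" using cover[OF i i] by blast
    then have "1 \<le> card (supp z)" using fin by (metis One_nat_def Suc_leI card_gt_0_iff empty_iff)
    \<comment> \<open>A nonempty support that misses at least two indices leaves three indices in
      \<open>P\<close>; the gradient of a zero on two of them is negative at the third.\<close>
    then have "3 \<le> card P" using small[OF z(1)] by linarith
    then obtain Q where "Q \<subseteq> P" "card Q = 3" by (meson obtain_subset_with_card_n)
    then obtain p q r where pqr: "p \<in> P" "q \<in> P" "r \<in> P" "p \<noteq> q" "q \<noteq> r" "p \<noteq> r"
      by (auto simp: card_3_iff)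
    obtain a where a: "zero_vec a" "p \<in> supp a" "q \<in> supp a" using cover[OF pqr(1,2)] by blast
    have "grad a r = S r p * a p + S r q * a q"
      using grad_eq_sum_supp[OF a(1) Pn[OF pqr(3)]] supp2[OF a pqr(4)] pqr by simp
    moreover have "S r p * a p < 0" "S r q * a q < 0"
      using a negS[of r p] negS[of r q] pqr by (auto simp: supp_def mult_less_0_iff)
    ultimately show False using zero_vec_grad(1)[OF a(1) Pn[OF pqr(3)]] by simp
  qed
qed

end

section \<open>Matrices orthogonal to a copositive form\<close>

lemma sum_bilin_decomp:
  assumes "cp_decomp n L v A"
  shows "(\<Sum>l\<in>L. bilin n S (v l) (v l)) = (\<Sum>i<n. \<Sum>j<n. S i j * A i j)"
proof -
  have "(\<Sum>l\<in>L. bilin n S (v l) (v l)) = (\<Sum>l\<in>L. \<Sum>i<n. \<Sum>j<n. S i j * (v l i * v l j))"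
    unfolding bilin_def sum_distrib_left by (intro sum.cong refl) simp
  also have "\<dots> = (\<Sum>i<n. \<Sum>l\<in>L. \<Sum>j<n. S i j * (v l i * v l j))"
    by (rule sum.swap)
  also have "\<dots> = (\<Sum>i<n. \<Sum>j<n. \<Sum>l\<in>L. S i j * (v l i * v l j))"
    by (rule sum.cong[OF refl]) (rule sum.swap)
  also have "\<dots> = (\<Sum>i<n. \<Sum>j<n. S i j * A i j)"
    by (intro sum.cong refl) (simp add: cp_decompD(3)[OF assms] sum_distrib_left)
  finally show ?thesis .
qed

text \<open>The complementarity equations are linear in the outer products and so hold for all their
  linear combinations. Each positive diagonal entry of \<open>S\<close> makes one diagonal position
  redundant in the Caratheodory count.\<close>

lemma cp_le_orthogonal_copositive:
  assumes n: "n \<ge> 5" and cp: "cp_le n k A" and pos: "\<And>i j. i < n \<Longrightarrow> j < n \<Longrightarrow> A i j > 0"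
    and sym: "symmetric n S" and cop: "copositive n S"
    and nz: "\<exists>i<n. \<exists>j<n. S i j \<noteq> 0" and orth: "(\<Sum>i<n. \<Sum>j<n. S i j * A i j) \<le> 0"
  shows "cp_le n (n * (n + 1) div 2 - 5) A"
proof -
  define P where "P = {i. i < n \<and> S i i > 0}"
  have zero: "bilin n S (v l) (v l) = 0" if dec: "cp_decomp n L v A" and l: "l \<in> L" for L v l
  proof -
    have ge: "0 \<le> bilin n S (v l) (v l)" if "l \<in> L" for l
      using cp_decompD(2)[OF dec that] by (intro copositiveD[OF cop]) simp
    then have "(\<Sum>l\<in>L. bilin n S (v l) (v l)) = 0"
      using orth sum_bilin_decomp[OF dec, of S] sum_nonneg[of L "\<lambda>l. bilin n S (v l) (v l)"] by simp
    then show ?thesis using ge l cp_decompD(1)[OF dec] by (subst (asm) sum_nonneg_eq_0_iff) auto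
  qed
  have compl: "v l i * (\<Sum>j<n. S i j * v l j) = 0" if "cp_decomp n L v A" "l \<in> L" "i < n" for L v l i
    using copositive_zero_gradient(2)[OF sym cop _ zero[OF that(1,2)] that(3)]
      cp_decompD(2)[OF that(1,2)] by blast
  have sum_compl: "(\<Sum>j<n. S i j * (\<Sum>l\<in>L. c l * (v l i * v l j))) = 0"
    if "cp_decomp n L v A" "i < n" for L v c i
  proof -
    have "(\<Sum>j<n. S i j * (\<Sum>l\<in>L. c l * (v l i * v l j)))
        = (\<Sum>j<n. \<Sum>l\<in>L. c l * (v l i * (S i j * v l j)))"
      unfolding sum_distrib_left by (intro sum.cong refl) simp
    also have "\<dots> = (\<Sum>l\<in>L. \<Sum>j<n. c l * (v l i * (S i j * v l j)))" by (rule sum.swap)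
    also have "\<dots> = (\<Sum>l\<in>L. c l * (v l i * (\<Sum>j<n. S i j * v l j)))"
      by (simp add: sum_distrib_left)
    also have "\<dots> = 0" using compl[OF that(1) _ that(2)] by simp
    finally show ?thesis .
  qed
  obtain L0 v0 where dec0: "cp_decomp n L0 v0 A" using cp by (auto simp: cp_le_def)
  \<comment> \<open>When \<open>S i i\<close> is 0, copositivity makes the rest of row
    \<open>i\<close> nonnegative. Complementarity, summed over a decomposition, makes that row
    orthogonal to the positive row \<open>i\<close> of \<open>A\<close>.\<close>
  have row: "S i j = 0" if i: "i < n" "i \<notin> P" and j: "j < n" for i j
  proof -
    let ?e = "\<lambda>i k. if k = i then 1 else 0 :: real"
    have diag: "0 \<le> S k k" if "k < n" for k
    proof -
      have "0 \<le> bilin n S (?e k) (?e k)"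
        by (intro copositiveD[OF cop]) simp
      then show ?thesis using bilin_unit_unit[OF that that, of S] by simp
    qed
    have Sii: "S i i = 0" using i diag[OF i(1)] by (auto simp: P_def)
    have ge: "0 \<le> S i j" if j: "j < n" for j
    proof (rule ccontr)
      assume neg: "\<not> 0 \<le> S i j"
      \<comment> \<open>This \<open>t\<close> makes the value of the form at
        \<open>e_j + t e_i\<close> equal to -1.\<close>
      define t where "t = (S j j + 1) / (- 2 * S i j)"
      have "t \<ge> 0" using neg diag[OF j] by (simp add: t_def field_simps)
      then have "0 \<le> bilin n S (\<lambda>k. ?e j k + t * ?e i k) (\<lambda>k. ?e j k + t * ?e i k)"
        by (intro copositiveD[OF cop]) simp
      also have "\<dots> = S j j + 2 * t * S j i + t\<^sup>2 * S i i"
        unfolding bilin_add_self[OF sym] bilin_unit_unit[OF j j] bilin_unit_unit[OF j i(1)]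
          bilin_unit_unit[OF i(1) i(1)] ..
      also have "\<dots> = S j j + 2 * t * S i j" using Sii sym i(1) j by (simp add: symmetric_def)
      also have "2 * t * S i j = - (S j j + 1)" using neg by (simp add: t_def field_simps)
      finally show False by simp
    qed
    have "(\<Sum>j<n. S i j * A i j) = 0"
      using sum_compl[OF dec0 i(1), of "\<lambda>_. 1"] cp_decompD(3)[OF dec0 i(1)] by simp
    then have "\<forall>j\<in>{..<n}. S i j * A i j = 0"
      using ge pos[OF i(1)] by (subst (asm) sum_nonneg_eq_0_iff) (auto simp: less_imp_le)
    then show ?thesis using j pos[OF i(1) j] by auto
  qed
  interpret copositive_form n S P
    using sym cop row by unfold_locales (auto simp: P_def)
  have arith: "n * (n + 1) div 2 = n * (n - 1) div 2 + n"
  proof -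
    have "n * (n + 1) = n * (n - 1) + n * 2" using n by (cases n) (auto simp: algebra_simps)
    then show ?thesis by simp
  qed
  show ?thesis
  proof (cases "card P \<le> 4")
    case True
    \<comment> \<open>A positive entry \<open>A i j\<close> requires a vector of the decomposition
      that is positive at both \<open>i\<close> and \<open>j\<close>.\<close>
    have cover: "\<exists>z. zero_vec z \<and> i \<in> supp z \<and> j \<in> supp z" if ij: "i \<in> P" "j \<in> P" for i j
    proof -
      have "i < n" "j < n" using ij by (auto simp: P_def)
      then have "(\<Sum>l\<in>L0. v0 l i * v0 l j) > 0" using pos cp_decompD(3)[OF dec0] by metis
      then obtain l where l: "l \<in> L0" "v0 l i * v0 l j > 0" by (meson not_less sum_nonpos)
      then have "v0 l i > 0" "v0 l j > 0"
        using cp_decompD(2)[OF dec0 l(1)] \<open>i < n\<close> \<open>j < n\<close> by (auto simp: zero_less_mult_iff dest: leD)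
      then show ?thesis using ij zero[OF dec0 l(1)] cp_decompD(2)[OF dec0 l(1)]
        by (intro exI[of _ "v0 l"]) (auto simp: zero_vec_def supp_def)
    qed
    have psd: "0 \<le> bilin n S x x" for x using psd_if_zeros_cover_pairs[OF True cover] .
    \<comment> \<open>A zero of a positive semidefinite form lies in its kernel: the first-order
      condition holds in the direction \<open>e_p\<close> and in its negative.\<close>
    have ker: "(\<Sum>j<n. S p j * v0 l j) = 0" if p: "p < n" and l: "l \<in> L0" for p l
    proof -
      let ?e = "\<lambda>k. if k = p then 1 else 0 :: real"
      have "0 \<le> 2 * t * b + t\<^sup>2 * bilin n S ?e ?e" if b: "b = bilin n S (v0 l) ?e \<or> b = - bilin n S (v0 l) ?e" for t b
      proof -
        have "0 \<le> 2 * t * bilin n S (v0 l) ?e + t\<^sup>2 * bilin n S ?e ?e" for t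
          using psd[of "\<lambda>k. v0 l k + t * ?e k"] zero[OF dec0 l] by (simp only: bilin_add_self[OF sym])
        from this[of t] this[of "- t"] b show ?thesis by auto
      qed
      then have "0 \<le> bilin n S (v0 l) ?e" "0 \<le> - bilin n S (v0 l) ?e"
        by (blast intro: linear_coeff_nonneg)+
      then show ?thesis using bilin_unit[OF p, of S "v0 l"] by (simp add: bilin_commute[OF sym, of "v0 l"])
    qed
    obtain p q where pq: "p < n" "q < n" "S p q \<noteq> 0" using nz by blast
    have "(\<Sum>j<n. S p j * A j m) = 0" if m: "m < n" for m
    proof -
      have "(\<Sum>j<n. S p j * A j m) = (\<Sum>j<n. \<Sum>l\<in>L0. S p j * v0 l j * v0 l m)"
        using m by (intro sum.cong refl) (simp add: cp_decompD(3)[OF dec0] sum_distrib_left mult.assoc)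
      also have "\<dots> = (\<Sum>l\<in>L0. (\<Sum>j<n. S p j * v0 l j) * v0 l m)"
        by (subst sum.swap) (simp add: sum_distrib_right)
      also have "\<dots> = 0" using ker[OF pq(1)] by simp
      finally show ?thesis .
    qed
    then have "cp_le n (n * (n - 1) div 2) A"
      using cp_le_singular[OF cp pq(2), of "S p"] pq(3) by blast
    \<comment> \<open>Here \<open>n \<ge> 5\<close> gives \<open>N - n \<le> N - 5\<close>.\<close>
    then show ?thesis by (rule cp_le_mono) (use arith n in linarith)
  next
    case False
    define E0 where "E0 = {(i, j). i \<in> {..<n} \<and> j \<in> {..<n} \<and> i \<le> j}"
    define E where "E = E0 - (\<lambda>i. (i, i)) ` P"
    have finE0: "finite E0" unfolding E0_def by (auto intro: finite_subset[of _ "{..<n} \<times> {..<n}"])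
    have "cp_le n (card E) A"
    proof (rule cp_le_card_equations[OF cp])
      show "finite E" using finE0 by (simp add: E_def)
      fix L v c i j
      assume dec: "cp_decomp n L v A" and ij: "i < n" "j < n"
        and e: "\<And>i j. (i, j) \<in> E \<Longrightarrow> (\<Sum>l\<in>L. c l * (v l i * v l j)) = (0::real)"
      have off: "(\<Sum>l\<in>L. c l * (v l i * v l j)) = 0" if "i < n" "j < n" "i \<noteq> j \<or> i \<notin> P" for i j
        using e[of i j] e[of j i] that by (cases "i \<le> j") (auto simp: E_def E0_def mult.commute)
      show "(\<Sum>l\<in>L. c l * (v l i * v l j)) = 0"
      proof (cases "i \<noteq> j \<or> i \<notin> P")
        case True
        then show ?thesis using off ij by blast
      next
        case False
        then have i: "i = j" "i \<in> P" by auto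
        \<comment> \<open>All off-diagonal entries of the combination already vanish, so equation
          \<open>i\<close> retains only the term with \<open>S i i\<close>.\<close>
        have "0 = (\<Sum>m<n. S i m * (\<Sum>l\<in>L. c l * (v l i * v l m)))"
          using sum_compl[OF dec ij(1)] by simp
        also have "\<dots> = S i i * (\<Sum>l\<in>L. c l * (v l i * v l i))"
          using ij off by (subst sum.mono_neutral_right[of "{..<n}" "{i}"]) auto
        finally show ?thesis using i diag_pos[OF i(2)] by auto
      qed
    qed
    moreover have "card E \<le> n * (n + 1) div 2 - 5"
    proof -
      have "(\<lambda>i. (i, i)) ` P \<subseteq> E0" using P_subset by (auto simp: E0_def)
      moreover have "card ((\<lambda>i. (i, i)) ` P) = card P" by (rule card_image) (auto simp: inj_on_def)
      moreover have "card E0 = n * (n + 1) div 2"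
        using card_ordered_pairs[of "{..<n}"] by (simp add: E0_def)
      ultimately have "card E = n * (n + 1) div 2 - card P"
        unfolding E_def using finite_P by (simp add: card_Diff_subset)
      then show ?thesis using False by simp
    qed
    ultimately show ?thesis by (rule cp_le_mono)
  qed
qed

section \<open>Closedness, separation and the improved upper bound\<close>

text \<open>Bolzano-Weierstrass for finitely many coordinates, passing to a further subsequence for
  each of them.\<close>

lemma bounded_family_convergent_subseq:
  fixes f :: "nat \<Rightarrow> 'i \<Rightarrow> real"
  assumes "finite I" "\<And>i. i \<in> I \<Longrightarrow> \<exists>C. \<forall>m. \<bar>f m i\<bar> \<le> C"
  shows "\<exists>r g. strict_mono (r :: nat \<Rightarrow> nat) \<and> (\<forall>i\<in>I. (\<lambda>m. f (r m) i) \<longlonglongrightarrow> g i)"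
  using assms
proof (induction I rule: finite_induct)
  case empty
  then show ?case by (intro exI[of _ id]) (auto simp: strict_mono_def)
next
  case (insert i I)
  then obtain r g where r: "strict_mono r" "\<forall>i\<in>I. (\<lambda>m. f (r m) i) \<longlonglongrightarrow> g i" by auto
  obtain C where C: "\<And>m. \<bar>f m i\<bar> \<le> C" using insert.prems by blast
  have "bounded (range (\<lambda>m. f (r m) i))"
    unfolding bounded_iff using C by auto
  then obtain x s where s: "strict_mono s" "((\<lambda>m. f (r m) i) \<circ> s) \<longlonglongrightarrow> x"
    using bounded_imp_convergent_subsequence by blast
  have "(\<lambda>m. f ((r \<circ> s) m) j) \<longlonglongrightarrow> (g(i := x)) j" if "j \<in> insert i I" for j
  proof (cases "j = i")
    case True
    then show ?thesis using s(2) by (simp add: o_def)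
  next
    case False
    then have "(\<lambda>m. f (r m) j) \<longlonglongrightarrow> g j" using r(2) that by simp
    then have "((\<lambda>m. f (r m) j) \<circ> s) \<longlonglongrightarrow> g j" using s(1) by (rule LIMSEQ_subseq_LIMSEQ)
    then show ?thesis using False by (simp add: o_def)
  qed
  moreover have "strict_mono (r \<circ> s)" using r(1) s(1) by (rule strict_mono_o)
  ultimately show ?case by blast
qed

text \<open>Bounds on the diagonal suffice, since the square of each entry of a factor is at most a
  diagonal entry. The factors then have a convergent subsequence.\<close>

lemma cp_le_convergent_subseq:
  assumes cp: "\<And>m. cp_le n k (B m)" and bd: "\<And>i. i < n \<Longrightarrow> \<exists>C. \<forall>m. B m i i \<le> C"
  shows "\<exists>r A. strict_mono (r :: nat \<Rightarrow> nat) \<and> cp_le n k A \<and>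
    (\<forall>i<n. \<forall>j<n. (\<lambda>m. B (r m) i j) \<longlonglongrightarrow> A i j)"
proof -
  have "\<forall>m. \<exists>v. cp_decomp n {..<k} v (B m)" using cp by (auto simp: cp_le_lessThan)
  then obtain v where v: "\<And>m. cp_decomp n {..<k} (v m) (B m)" by metis
  have "\<exists>C. \<forall>m. \<bar>v m l i\<bar> \<le> C" if l: "l < k" and i: "i < n" for l i
  proof -
    obtain C where C: "\<And>m. B m i i \<le> C" using bd[OF i] by blast
    have "\<bar>v m l i\<bar> \<le> C + 1" for m
    proof -
      have "v m l i * v m l i \<le> (\<Sum>l<k. v m l i * v m l i)"
        using l by (intro member_le_sum) auto
      also have "\<dots> \<le> C" using cp_decompD(3)[OF v i i, of m] C[of m] by simp
      finally have "\<bar>v m l i\<bar>\<^sup>2 \<le> C" by (simp add: power2_eq_square)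
      moreover have "2 * \<bar>v m l i\<bar> \<le> \<bar>v m l i\<bar>\<^sup>2 + 1"
        using zero_le_power2[of "\<bar>v m l i\<bar> - 1"] unfolding power2_diff by simp
      ultimately show ?thesis by linarith
    qed
    then show ?thesis by blast
  qed
  then obtain r g where r: "strict_mono r" "\<forall>p\<in>{..<k} \<times> {..<n}. (\<lambda>m. v (r m) (fst p) (snd p)) \<longlonglongrightarrow> g p"
    using bounded_family_convergent_subseq[of "{..<k} \<times> {..<n}" "\<lambda>m p. v m (fst p) (snd p)"] by auto
  define w where "w = (\<lambda>l i. g (l, i))"
  have lim: "(\<lambda>m. v (r m) l i) \<longlonglongrightarrow> w l i" if "l < k" "i < n" for l i
    using r(2) that by (auto simp: w_def)
  define A where "A = (\<lambda>i j. \<Sum>l<k. w l i * w l j)"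
  have "0 \<le> w l i" if "l < k" "i < n" for l i
    using cp_decompD(2)[OF v] that by (intro LIMSEQ_le_const[OF lim[OF that]]) auto
  then have "cp_decomp n {..<k} w A" by (auto simp: cp_decomp_def A_def)
  then have "cp_le n k A" unfolding cp_le_lessThan by blast
  moreover have "(\<lambda>m. B (r m) i j) \<longlonglongrightarrow> A i j" if ij: "i < n" "j < n" for i j
    unfolding A_def cp_decompD(3)[OF v ij] using lim ij by (intro tendsto_intros) auto
  ultimately show ?thesis using r(1) by blast
qed

lemma cp_le_closed:
  assumes cp: "\<And>m. cp_le n k (B m)"
    and lim: "\<And>i j. i < n \<Longrightarrow> j < n \<Longrightarrow> (\<lambda>m. B m i j) \<longlonglongrightarrow> A i j"
  shows "cp_le n k A"
proof -
  have bd: "\<exists>C. \<forall>m. B m i i \<le> C" if "i < n" for i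
  proof -
    have "Bseq (\<lambda>m. B m i i)" using lim[OF that that] by (intro convergent_imp_Bseq convergentI)
    then obtain C where "\<And>m. norm (B m i i) \<le> C" by (auto simp: Bseq_def)
    then have "B m i i \<le> C" for m using abs_le_D1 real_norm_def by metis
    then show ?thesis by blast
  qed
  obtain r A' where r: "strict_mono r" "cp_le n k A'"
    "\<forall>i<n. \<forall>j<n. (\<lambda>m. B (r m) i j) \<longlonglongrightarrow> A' i j"
    using cp_le_convergent_subseq[OF cp bd] by auto
  have "A' i j = A i j" if "i < n" "j < n" for i j
    using LIMSEQ_subseq_LIMSEQ[OF lim[OF that] r(1)] r(3) that
    by (auto simp: o_def intro: LIMSEQ_unique)
  then show ?thesis using cp_le_cong r(2) by blast
qed

lemma cp_le_closed_approx:
  assumes "\<And>e. e > 0 \<Longrightarrow> \<exists>B. cp_le n k B \<and> (\<forall>i<n. \<forall>j<n. \<bar>B i j - A i j\<bar> < e)"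
  shows "cp_le n k A"
proof -
  have "\<forall>m. \<exists>B. cp_le n k B \<and> (\<forall>i<n. \<forall>j<n. \<bar>B i j - A i j\<bar> < inverse (real (Suc m)))"
    using assms by simp
  then obtain B where B: "\<And>m. cp_le n k (B m)"
    "\<And>m i j. i < n \<Longrightarrow> j < n \<Longrightarrow> \<bar>B m i j - A i j\<bar> < inverse (real (Suc m))" by metis
  show ?thesis
  proof (rule cp_le_closed[OF B(1)])
    fix i j assume ij: "i < n" "j < n"
    have "(\<lambda>m. B m i j - A i j) \<longlonglongrightarrow> 0"
      using B(2)[OF ij] by (intro Lim_null_comparison[OF _ LIMSEQ_inverse_real_of_nat]) (auto simp: less_imp_le)
    then show "(\<lambda>m. B m i j) \<longlonglongrightarrow> A i j" by (simp add: LIM_zero_iff)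
  qed
qed

lemma cp_le_add_rank_one:
  assumes cp: "cp_le n k A" and x: "\<And>i. i < n \<Longrightarrow> 0 \<le> x i" and t: "0 \<le> t"
  shows "cp_le n (Suc k) (\<lambda>i j. A i j + t * (x i * x j))"
proof -
  obtain v where v: "cp_decomp n {..<k} v A" using cp by (auto simp: cp_le_lessThan)
  define w where "w = v(k := \<lambda>i. sqrt t * x i)"
  have "(\<Sum>l<Suc k. w l i * w l j) = A i j + t * (x i * x j)" if "i < n" "j < n" for i j
  proof -
    have "w k i * w k j = (sqrt t * sqrt t) * (x i * x j)" by (simp add: w_def algebra_simps)
    then show ?thesis using t cp_decompD(3)[OF v that] by (simp add: w_def)
  qed
  then have "cp_decomp n {..<Suc k} w (\<lambda>i j. A i j + t * (x i * x j))"
    using v x t by (auto simp: cp_decomp_def w_def)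
  then show ?thesis unfolding cp_le_lessThan by blast
qed

lemma cp_le_scale:
  assumes cp: "cp_le n k A" and t: "0 \<le> t"
  shows "cp_le n k (\<lambda>i j. t * A i j)"
proof -
  obtain v where v: "cp_decomp n {..<k} v A" using cp by (auto simp: cp_le_lessThan)
  have sq: "(sqrt t * a) * (sqrt t * b) = t * (a * b)" for a b
  proof -
    have "(sqrt t * a) * (sqrt t * b) = (sqrt t * sqrt t) * (a * b)" by (simp only: ac_simps)
    then show ?thesis using t by simp
  qed
  have "(\<Sum>l<k. (sqrt t * v l i) * (sqrt t * v l j)) = t * A i j" if "i < n" "j < n" for i j
    unfolding sq cp_decompD(3)[OF v that] by (rule sum_distrib_left[symmetric])
  then have "cp_decomp n {..<k} (\<lambda>l i. sqrt t * v l i) (\<lambda>i j. t * A i j)"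
    using cp_decompD(2)[OF v] t unfolding cp_decomp_def by simp
  then show ?thesis unfolding cp_le_lessThan by blast
qed

lemma cp_le_imp_symmetric: "cp_le n k A \<Longrightarrow> symmetric n A"
  by (auto simp: cp_le_def cp_decomp_def symmetric_def mult.commute)

section \<open>Projection onto the cone and separation by copositive forms\<close>

definition frob :: "nat \<Rightarrow> (nat \<Rightarrow> nat \<Rightarrow> real) \<Rightarrow> (nat \<Rightarrow> nat \<Rightarrow> real) \<Rightarrow> real" where
  "frob n A B = (\<Sum>i<n. \<Sum>j<n. A i j * B i j)"

lemma frob_outer: "frob n S (\<lambda>i j. x i * x j) = bilin n S x x"
  by (simp add: frob_def bilin_def sum_distrib_left algebra_simps)

lemma frob_ge_square:
  assumes "i < n" "j < n"
  shows "(A i j)\<^sup>2 \<le> frob n A A"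
proof -
  have "A i j * A i j \<le> (\<Sum>j<n. A i j * A i j)" using assms by (intro member_le_sum) auto
  also have "\<dots> \<le> frob n A A" unfolding frob_def
    using assms by (intro member_le_sum[of i "{..<n}" "\<lambda>i. \<Sum>j<n. A i j * A i j"]) (auto intro: sum_nonneg)
  finally show ?thesis by (simp add: power2_eq_square)
qed

lemma frob_nonneg: "0 \<le> frob n A A"
  by (simp add: frob_def sum_nonneg)

lemma frob_add_self:
  "frob n (\<lambda>i j. A i j + t * B i j) (\<lambda>i j. A i j + t * B i j)
    = frob n A A + 2 * t * frob n A B + t\<^sup>2 * frob n B B"
proof -
  have e: "(A i j + t * B i j) * (A i j + t * B i j)
      = A i j * A i j + 2 * t * (A i j * B i j) + t\<^sup>2 * (B i j * B i j)" for i j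
    by (simp add: power2_eq_square algebra_simps)
  show ?thesis unfolding frob_def e by (simp only: sum.distrib sum_distrib_left)
qed

lemma frob_tendsto:
  assumes "\<And>i j. i < n \<Longrightarrow> j < n \<Longrightarrow> (\<lambda>m. A m i j) \<longlonglongrightarrow> A' i j"
    "\<And>i j. i < n \<Longrightarrow> j < n \<Longrightarrow> (\<lambda>m. B m i j) \<longlonglongrightarrow> B' i j"
  shows "(\<lambda>m. frob n (A m) (B m)) \<longlonglongrightarrow> frob n A' B'"
  unfolding frob_def using assms by (intro tendsto_sum tendsto_mult) auto

text \<open>A minimizing sequence has bounded diagonals. Since \<open>N\<close> vectors always
  suffice, the compactness result for a fixed number of vectors applies to the whole cone.\<close>

lemma nearest_cp_exists:
  fixes n :: nat
  defines "N \<equiv> n * (n + 1) div 2"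
  shows "\<exists>Y. cp_le n N Y \<and> (\<forall>k Z. cp_le n k Z \<longrightarrow>
    frob n (\<lambda>i j. Y i j - X i j) (\<lambda>i j. Y i j - X i j) \<le> frob n (\<lambda>i j. Z i j - X i j) (\<lambda>i j. Z i j - X i j))"
proof -
  define D where "D = (\<lambda>Z. frob n (\<lambda>i j. Z i j - X i j) (\<lambda>i j. Z i j - X i j))"
  define d where "d = Inf (D ` {Z. cp_le n N Z})"
  have "cp_decomp n {} (\<lambda>_ _. 0) (\<lambda>_ _. 0)" by (simp add: cp_decomp_def)
  then have ne: "{Z. cp_le n N Z} \<noteq> {}" by (force simp: cp_le_def)
  have bdd: "bdd_below (D ` {Z. cp_le n N Z})"
    by (rule bdd_belowI[of _ 0]) (auto simp: D_def frob_nonneg)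
  have d_le: "d \<le> D Z" if "cp_le n k Z" for k Z
    unfolding d_def using cp_le_binomial[OF that] by (intro cINF_lower[OF bdd]) (simp add: N_def)
  have "\<exists>Z. cp_le n N Z \<and> D Z < d + inverse (real (Suc m))" for m
  proof -
    have "\<exists>y\<in>D ` {Z. cp_le n N Z}. y < d + inverse (real (Suc m))"
      unfolding d_def using ne by (intro cInf_lessD) auto
    then show ?thesis by auto
  qed
  then obtain Z where Z: "\<And>m. cp_le n N (Z m)" "\<And>m. D (Z m) < d + inverse (real (Suc m))" by metis
  have bd: "\<exists>C. \<forall>m. Z m i i \<le> C" if i: "i < n" for i
  proof -
    have "Z m i i \<le> X i i + (d + 2)" for m
    proof -
      have "inverse (real (Suc m)) \<le> 1" by (simp add: inverse_le_1_iff)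
      then have "(Z m i i - X i i)\<^sup>2 \<le> d + 1"
        using frob_ge_square[OF i i, of "\<lambda>i j. Z m i j - X i j"] Z(2)[of m] by (simp add: D_def)
      moreover have "2 * y \<le> y\<^sup>2 + 1" "0 \<le> y\<^sup>2" for y :: real
        using zero_le_power2[of "y - 1"] by (simp_all add: power2_eq_square algebra_simps)
      ultimately show ?thesis by (smt (verit))
    qed
    then show ?thesis by blast
  qed
  obtain r Y where r: "strict_mono r" "cp_le n N Y"
    "\<forall>i<n. \<forall>j<n. (\<lambda>m. Z (r m) i j) \<longlonglongrightarrow> Y i j"
    using cp_le_convergent_subseq[OF Z(1) bd] by auto
  have "(\<lambda>m. D (Z (r m))) \<longlonglongrightarrow> D Y"
    unfolding D_def using r(3) by (intro frob_tendsto tendsto_intros) auto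
  moreover have "(\<lambda>m. d + inverse (real (Suc (r m)))) \<longlonglongrightarrow> d"
    using LIMSEQ_subseq_LIMSEQ[OF LIMSEQ_inverse_real_of_nat_add[of d] r(1)] by (simp add: o_def)
  ultimately have "D Y \<le> d"
    by (rule LIMSEQ_le) (use Z(2) in \<open>auto simp: less_imp_le\<close>)
  then have "\<forall>k Z. cp_le n k Z \<longrightarrow> D Y \<le> D Z" using d_le order_trans by blast
  then show ?thesis using r(2) unfolding D_def by blast
qed

text \<open>The form is the normalized difference of the nearest point \<open>Y\<close> and
  \<open>X\<close>. Minimality under adding \<open>t x x\<^sup>T\<close> to \<open>Y\<close> gives
  copositivity, and minimality under shrinking \<open>Y\<close> gives a nonpositive product with
  \<open>Y\<close>, hence with \<open>X\<close>.\<close>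

lemma copositive_separation:
  assumes X: "symmetric n X" "\<not> (\<exists>k. cp_le n k X)"
  shows "\<exists>S. symmetric n S \<and> copositive n S \<and> frob n S S = 1 \<and> frob n S X \<le> 0"
proof -
  obtain Y where Y: "cp_le n (n * (n + 1) div 2) Y"
    and min: "\<And>k Z. cp_le n k Z \<Longrightarrow>
      frob n (\<lambda>i j. Y i j - X i j) (\<lambda>i j. Y i j - X i j) \<le> frob n (\<lambda>i j. Z i j - X i j) (\<lambda>i j. Z i j - X i j)"
    using nearest_cp_exists[of n X] by blast
  define S where "S = (\<lambda>i j. Y i j - X i j)"
  have var: "0 \<le> 2 * t * frob n S E + t\<^sup>2 * frob n E E" if "cp_le n k (\<lambda>i j. Y i j + t * E i j)" for t E k
  proof -
    have "frob n S S \<le> frob n (\<lambda>i j. S i j + t * E i j) (\<lambda>i j. S i j + t * E i j)"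
      using min[OF that] by (simp add: S_def algebra_simps)
    then show ?thesis by (simp add: frob_add_self)
  qed
  have cop: "0 \<le> bilin n S x x" if x: "\<And>i. i < n \<Longrightarrow> 0 \<le> x i" for x
    unfolding frob_outer[symmetric]
    by (rule linear_coeff_nonneg, rule var, rule cp_le_add_rank_one[OF Y x]) auto
  have "0 \<le> frob n S (\<lambda>i j. - Y i j)"
  proof (rule linear_coeff_nonneg, rule var)
    fix t :: real assume "0 < t" "t \<le> 1"
    then have "cp_le n (n * (n + 1) div 2) (\<lambda>i j. (1 - t) * Y i j)"
      by (intro cp_le_scale[OF Y]) simp
    then show "cp_le n (n * (n + 1) div 2) (\<lambda>i j. Y i j + t * (- Y i j))" by (simp add: algebra_simps)
  qed
  then have SY: "frob n S Y \<le> 0" by (simp add: frob_def sum_negf)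
  have "frob n S S = frob n S Y - frob n S X"
  proof -
    have "S i j * S i j = S i j * Y i j - S i j * X i j" for i j
      by (simp add: S_def algebra_simps)
    then show ?thesis by (simp add: frob_def sum_subtractf)
  qed
  then have SX: "frob n S X \<le> 0" using SY frob_nonneg[of n S] by linarith
  have "frob n S S \<noteq> 0"
  proof
    assume "frob n S S = 0"
    then have "Y i j = X i j" if "i < n" "j < n" for i j
      using frob_ge_square[OF that, of S] by (simp add: S_def)
    then show False using X(2) Y cp_le_cong by metis
  qed
  then have pos: "frob n S S > 0" using frob_nonneg[of n S] by simp
  \<comment> \<open>Norm 1 keeps the limit of such forms away from 0.\<close>
  define c where "c = inverse (sqrt (frob n S S))"
  have c: "c > 0" "c * c * frob n S S = 1"
    using pos by (auto simp: c_def field_simps)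
  define T where "T = (\<lambda>i j. c * S i j)"
  have "symmetric n T"
    using X(1) cp_le_imp_symmetric[OF Y] by (simp add: symmetric_def T_def S_def)
  moreover have "bilin n T x x = c * bilin n S x x" for x
    by (simp add: bilin_def T_def sum_distrib_left algebra_simps)
  then have "copositive n T" using c(1) cop by (simp add: copositive_def)
  moreover have "frob n T T = c * c * frob n S S" "frob n T X = c * frob n S X"
    by (simp_all add: frob_def T_def sum_distrib_left algebra_simps)
  ultimately show ?thesis using c SX by (metis mult_nonneg_nonpos less_imp_le)
qed

text \<open>Matrices outside the cone that converge to \<open>A\<close> are separated by forms of
  norm 1; a limit of a subsequence of these forms is as required.\<close>

lemma boundary_orthogonal_copositive:
  assumes "\<And>e. e > 0 \<Longrightarrow> \<exists>X. symmetric n X \<and> \<not> (\<exists>k. cp_le n k X) \<and> (\<forall>i<n. \<forall>j<n. \<bar>X i j - A i j\<bar> < e)"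
  shows "\<exists>S. symmetric n S \<and> copositive n S \<and> (\<exists>i<n. \<exists>j<n. S i j \<noteq> 0) \<and> frob n S A \<le> 0"
proof -
  have "\<forall>m. \<exists>X. symmetric n X \<and> \<not> (\<exists>k. cp_le n k X) \<and>
      (\<forall>i<n. \<forall>j<n. \<bar>X i j - A i j\<bar> < inverse (real (Suc m)))"
    using assms by simp
  from choice[OF this] obtain X where sep: "\<And>m. symmetric n (X m)" "\<And>m. \<not> (\<exists>k. cp_le n k (X m))"
    and X: "\<And>m i j. i < n \<Longrightarrow> j < n \<Longrightarrow> \<bar>X m i j - A i j\<bar> < inverse (real (Suc m))"
    by blast
  have "\<forall>m. \<exists>S. symmetric n S \<and> copositive n S \<and> frob n S S = 1 \<and> frob n S (X m) \<le> 0"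
    using copositive_separation[OF sep] by blast
  from choice[OF this] obtain S where S: "\<And>m. symmetric n (S m)" "\<And>m. copositive n (S m)"
    "\<And>m. frob n (S m) (S m) = 1" "\<And>m. frob n (S m) (X m) \<le> 0"
    by blast
  have "\<bar>S m i j\<bar> \<le> 1" if "i < n" "j < n" for m i j
    using frob_ge_square[OF that, of "S m"] S(3) by (simp add: abs_square_le_1)
  then have bd: "\<exists>C. \<forall>m. \<bar>S m (fst p) (snd p)\<bar> \<le> C" if "p \<in> {..<n} \<times> {..<n}" for p
    using that by (intro exI[of _ 1]) auto
  obtain r g where r: "strict_mono r" and
    g: "\<forall>p\<in>{..<n} \<times> {..<n}. (\<lambda>m. S (r m) (fst p) (snd p)) \<longlonglongrightarrow> g p"
    using bounded_family_convergent_subseq[of "{..<n} \<times> {..<n}" "\<lambda>m p. S m (fst p) (snd p)", OF _ bd]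
    by auto
  define T where "T = (\<lambda>i j. g (i, j))"
  have lim: "(\<lambda>m. S (r m) i j) \<longlonglongrightarrow> T i j" if "i < n" "j < n" for i j
    using g that by (auto simp: T_def)
  have limX: "(\<lambda>m. X (r m) i j) \<longlonglongrightarrow> A i j" if ij: "i < n" "j < n" for i j
  proof -
    have "(\<lambda>m. X m i j - A i j) \<longlonglongrightarrow> 0"
      using X[OF ij] by (intro Lim_null_comparison[OF _ LIMSEQ_inverse_real_of_nat]) (auto simp: less_imp_le)
    then have "(\<lambda>m. X m i j) \<longlonglongrightarrow> A i j" by (simp add: LIM_zero_iff)
    from LIMSEQ_subseq_LIMSEQ[OF this r] show ?thesis by (simp add: o_def)
  qed
  have "T i j = T j i" if ij: "i < n" "j < n" for i j
  proof -
    have "(\<lambda>m. S (r m) i j) = (\<lambda>m. S (r m) j i)" using S(1) ij by (auto simp: symmetric_def)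
    then show ?thesis using lim[OF ij] lim[OF ij(2,1)] LIMSEQ_unique by metis
  qed
  then have "symmetric n T" by (simp add: symmetric_def)
  moreover have "copositive n T"
    unfolding copositive_def
  proof (intro allI impI)
    fix x :: "nat \<Rightarrow> real" assume x: "\<forall>i<n. 0 \<le> x i"
    have "(\<lambda>m. bilin n (S (r m)) x x) \<longlonglongrightarrow> bilin n T x x"
      unfolding bilin_def using lim by (intro tendsto_intros) auto
    then show "0 \<le> bilin n T x x"
      using copositiveD[OF S(2)] x by (intro LIMSEQ_le_const) auto
  qed
  moreover have "(\<lambda>m. frob n (S (r m)) (S (r m))) \<longlonglongrightarrow> frob n T T"
    by (rule frob_tendsto[OF lim lim])
  then have "frob n T T = 1" using S(3) by (simp add: LIMSEQ_const_iff)
  then have "\<exists>i<n. \<exists>j<n. T i j \<noteq> 0"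
    by (rule_tac ccontr) (simp add: frob_def)
  moreover have "(\<lambda>m. frob n (S (r m)) (X (r m))) \<longlonglongrightarrow> frob n T A"
    by (rule frob_tendsto[OF lim limX])
  then have "frob n T A \<le> 0" using S(4) by (intro LIMSEQ_le_const2) auto
  ultimately show ?thesis by blast
qed

section \<open>From the boundary to all completely positive matrices\<close>

lemma cp_le_boundary_positive:
  assumes "n \<ge> 5" "cp_le n k A" "\<And>i j. i < n \<Longrightarrow> j < n \<Longrightarrow> A i j > 0"
    and "\<And>e. e > 0 \<Longrightarrow> \<exists>X. symmetric n X \<and> \<not> (\<exists>k. cp_le n k X) \<and> (\<forall>i<n. \<forall>j<n. \<bar>X i j - A i j\<bar> < e)"
  shows "cp_le n (n * (n + 1) div 2 - 5) A"
  using boundary_orthogonal_copositive[OF assms(4)] cp_le_orthogonal_copositive[OF assms(1-3)]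
  unfolding frob_def by blast

text \<open>The largest multiple of \<open>e_0 e_0\<^sup>T\<close> that can be subtracted within the
  cone leads to a boundary matrix; adding it back costs one vector.\<close>

lemma cp_le_positive:
  assumes n: "n \<ge> 5" and cp: "cp_le n k A" and pos: "\<And>i j. i < n \<Longrightarrow> j < n \<Longrightarrow> A i j > 0"
  shows "cp_le n (n * (n + 1) div 2 - 4) A"
proof -
  define e :: "nat \<Rightarrow> real" where "e = (\<lambda>k. if k = 0 then 1 else 0)"
  define B where "B = (\<lambda>t i j. A i j - t * (e i * e j))"
  define T where "T = {t. 0 \<le> t \<and> (\<exists>k. cp_le n k (B t))}"
  have T0: "0 \<in> T" using cp by (auto simp: T_def B_def)
  have diag: "0 \<le> C i i" if "cp_le n k C" "i < n" for C k i
    using that by (auto simp: cp_le_def cp_decomp_def intro!: sum_nonneg)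
  have bdd: "bdd_above T"
  proof (rule bdd_aboveI)
    fix t assume "t \<in> T"
    then have "0 \<le> B t 0 0" using diag[of _ "B t" 0] n by (auto simp: T_def)
    then show "t \<le> A 0 0" by (simp add: B_def e_def)
  qed
  define t0 where "t0 = Sup T"
  have t0: "0 \<le> t0" using cSup_upper[OF T0 bdd] by (simp add: t0_def)
  have diff: "\<bar>B s i j - B t i j\<bar> \<le> \<bar>s - t\<bar>" for s t i j
    by (simp add: B_def e_def abs_minus_commute)
  \<comment> \<open>The supremum is attained: all the approximating matrices share the bound
    \<open>N\<close> on the number of vectors, and this class is closed.\<close>
  have cpB: "cp_le n (n * (n + 1) div 2) (B t0)"
  proof (rule cp_le_closed_approx)
    fix d :: real assume d: "d > 0"
    then obtain t where t: "t \<in> T" "t0 - d < t"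
      using less_cSup_iff[of T "t0 - d"] T0 bdd by (auto simp: t0_def)
    then have "t \<le> t0" using cSup_upper[OF _ bdd] by (simp add: t0_def)
    then have close: "\<bar>B t i j - B t0 i j\<bar> < d" for i j using diff[of t i j t0] t(2) by linarith
    show "\<exists>B'. cp_le n (n * (n + 1) div 2) B' \<and> (\<forall>i<n. \<forall>j<n. \<bar>B' i j - B t0 i j\<bar> < d)"
    proof -
      obtain k where "cp_le n k (B t)" using t(1) by (auto simp: T_def)
      then have "cp_le n (n * (n + 1) div 2) (B t)" by (rule cp_le_binomial)
      then show ?thesis using close by blast
    qed
  qed
  have symB: "symmetric n (B t)" for t
  proof -
    have "A i j = A j i" if "i < n" "j < n" for i j
      using cp_le_imp_symmetric[OF cp] that unfolding symmetric_def by blast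
    then show ?thesis unfolding symmetric_def B_def by (metis mult.commute)
  qed
  have posB: "B t0 i j > 0" if ij: "i < n" "j < n" for i j
  proof (cases "i = 0 \<and> j = 0")
    case False
    then show ?thesis using pos[OF ij] by (auto simp: B_def e_def)
  next
    case True
    obtain L v where dec: "cp_decomp n L v (B t0)" using cpB by (auto simp: cp_le_def)
    \<comment> \<open>The corner stays positive: the unchanged positive entry at (0, 1) forces some
      vector to be positive at 0.\<close>
    have "B t0 0 1 = A 0 1" by (simp add: B_def e_def)
    then have "(\<Sum>l\<in>L. v l 0 * v l 1) > 0"
      using pos[of 0 1] n cp_decompD(3)[OF dec, of 0 1] by simp
    then obtain l where l: "l \<in> L" "v l 0 * v l 1 > 0" by (meson not_less sum_nonpos)
    then have "v l 0 * v l 0 > 0" by (auto simp: zero_less_mult_iff)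
    also have "v l 0 * v l 0 \<le> (\<Sum>l\<in>L. v l 0 * v l 0)"
      using l cp_decompD(1)[OF dec] by (intro member_le_sum) auto
    finally show ?thesis using True n cp_decompD(3)[OF dec, of 0 0] by simp
  qed
  have "cp_le n (n * (n + 1) div 2 - 5) (B t0)"
  proof (rule cp_le_boundary_positive[OF n cpB posB])
    fix d :: real assume d: "d > 0"
    have "\<not> (\<exists>k. cp_le n k (B (t0 + d / 2)))"
    proof
      assume "\<exists>k. cp_le n k (B (t0 + d / 2))"
      then have "t0 + d / 2 \<in> T" using t0 d by (simp add: T_def)
      then show False using cSup_upper[OF _ bdd] d by (force simp: t0_def)
    qed
    moreover have "\<bar>B (t0 + d / 2) i j - B t0 i j\<bar> < d" for i j
      using diff[of "t0 + d / 2" i j t0] d by linarith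
    ultimately show "\<exists>X. symmetric n X \<and> \<not> (\<exists>k. cp_le n k X) \<and> (\<forall>i<n. \<forall>j<n. \<bar>X i j - B t0 i j\<bar> < d)"
      using symB by blast
  qed auto
  then have "cp_le n (Suc (n * (n + 1) div 2 - 5)) (\<lambda>i j. B t0 i j + t0 * (e i * e j))"
    by (rule cp_le_add_rank_one) (use t0 in \<open>auto simp: e_def\<close>)
  then have c: "cp_le n (Suc (n * (n + 1) div 2 - 5)) A" by (simp add: B_def)
  have "10 \<le> n * (n + 1)" using n mult_le_mono[of 5 n 2 "n + 1"] by simp
  then have "n * (n + 1) div 2 \<ge> 5" using div_le_mono[of 10 "n * (n + 1)" 2] by simp
  then have "Suc (n * (n + 1) div 2 - 5) = n * (n + 1) div 2 - 4" by linarith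
  then show ?thesis using c by simp
qed

text \<open>A small multiple of the all-ones matrix, which is a rank-one update, makes all entries
  positive; closedness removes it again.\<close>

lemma cp_le_improved:
  assumes n: "n \<ge> 5" and cp: "cp_le n k A"
  shows "cp_le n (n * (n + 1) div 2 - 4) A"
proof (rule cp_le_closed_approx)
  fix e :: real assume e: "e > 0"
  define B where "B = (\<lambda>i j. A i j + e / 2 * (1 * 1))"
  have "cp_le n (Suc k) B"
    unfolding B_def using cp by (rule cp_le_add_rank_one) (use e in auto)
  moreover have "0 < B i j" if "i < n" "j < n" for i j
  proof -
    have "0 \<le> A i j" using cp that by (auto simp: cp_le_def cp_decomp_def intro!: sum_nonneg)
    then show ?thesis using e by (simp add: B_def)
  qed
  ultimately have "cp_le n (n * (n + 1) div 2 - 4) B" by (rule cp_le_positive[OF n])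
  then show "\<exists>B. cp_le n (n * (n + 1) div 2 - 4) B \<and> (\<forall>i<n. \<forall>j<n. \<bar>B i j - A i j\<bar> < e)"
    using e by (intro exI[of _ B]) (simp add: B_def)
qed

section \<open>A matrix of rank n with large cp-rank\<close>

text \<open>The vectors \<open>2 e\<^sub>a + e\<^sub>b\<close> with \<open>a \<noteq> b\<close> span the zero rays of \<open>5 (\<Sum>y\<^sub>k)\<^sup>2 - 9 (\<Sum>y\<^sub>k\<^sup>2)\<close> on the cone
  \<open>0 \<le> 3 y\<^sub>j \<le> 2 (\<Sum>y\<^sub>k)\<close>. Their outer products span a space of dimension \<open>N - 1\<close>, and those with
  \<open>a < b\<close> or \<open>b = 0\<close> form a basis. For \<open>0 < i < j\<close> the facet inequality is sharpened to
  \<open>3 y\<^sub>j + y\<^sub>i \<le> 2 (\<Sum>y\<^sub>k)\<close>, which cuts off precisely the rays outside this basis. Row \<open>n + i n + j\<close> of the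
  matrix below belongs to the facet functional with indices \<open>i\<close> and \<open>j\<close>.\<close>

definition ray_index :: "nat \<Rightarrow> (nat \<times> nat) set" where
  "ray_index n = {(i, j). i < j \<and> j < n} \<union> (\<lambda>j. (j, 0)) ` {1..<n}"

definition ray_vec :: "nat \<times> nat \<Rightarrow> nat \<Rightarrow> real" where
  "ray_vec p k = (if k = fst p then 2 else if k = snd p then 1 else 0)"

definition facet_coeff :: "nat \<Rightarrow> nat \<Rightarrow> nat \<Rightarrow> real" where
  "facet_coeff n r k = (if r < n then if k = r then 1 else 0
     else let i = (r - n) div n; j = (r - n) mod n in
       2 - (if k = j then 3 else 0) - (if 0 < i \<and> i < j \<and> k = i then 1 else 0))"

definition facet_ext :: "nat \<Rightarrow> (nat \<Rightarrow> real) \<Rightarrow> nat \<Rightarrow> real" where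
  "facet_ext n y r = (\<Sum>k<n. facet_coeff n r k * y k)"

definition ray_mat :: "nat \<Rightarrow> nat \<Rightarrow> nat \<Rightarrow> real" where
  "ray_mat n r s = (\<Sum>t\<in>ray_index n. facet_ext n (ray_vec t) r * facet_ext n (ray_vec t) s)"

section \<open>The rays and the facet functionals\<close>

lemma finite_ray_index: "finite (ray_index n)"
proof -
  have "ray_index n \<subseteq> {..<n} \<times> {..<n}" by (auto simp: ray_index_def)
  then show ?thesis using finite_subset by blast
qed

text \<open>Compared with the pairs \<open>i \<le> j\<close>, the \<open>n\<close> diagonal pairs
  are replaced by the \<open>n - 1\<close> pairs \<open>(j, 0)\<close>.\<close>

lemma card_ray_index:
  assumes "n \<ge> 1"
  shows "card (ray_index n) + 1 = n * (n + 1) div 2"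
proof -
  let ?D = "{(i, j). i \<in> {..<n} \<and> j \<in> {..<n} \<and> i \<le> j}"
  have fin: "finite {(i, j). i < j \<and> j < n}"
    by (rule finite_subset[of _ "{..<n} \<times> {..<n}"]) auto
  have D: "?D = {(i, j). i < j \<and> j < n} \<union> (\<lambda>i. (i, i)) ` {..<n}" by force
  have "card ?D = card {(i, j). i < j \<and> j < n} + n"
    unfolding D by (subst card_Un_disjoint) (auto simp: fin card_image inj_on_def)
  moreover have "card (ray_index n) = card {(i, j). i < j \<and> j < n} + (n - 1)"
    unfolding ray_index_def
    by (subst card_Un_disjoint) (auto simp: fin card_image inj_on_def)
  ultimately show ?thesis using assms card_ordered_pairs[of "{..<n}"] by simp
qed

lemma facet_ext_low: "r < n \<Longrightarrow> facet_ext n y r = y r"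
  unfolding facet_ext_def facet_coeff_def using sum_delta_mult[of "{..<n}" r y] by simp

lemma facet_ext_high:
  assumes ij: "i < n" "j < n"
  shows "facet_ext n y (n + i * n + j) = 2 * (\<Sum>k<n. y k) - 3 * y j - (if 0 < i \<and> i < j then y i else 0)"
proof -
  have dm: "(n + i * n + j - n) div n = i" "(n + i * n + j - n) mod n = j"
    using ij by (simp_all add: div_add1_eq)
  have "facet_coeff n (n + i * n + j) k * y k = 2 * y k - 3 * ((if k = j then 1 else 0) * y k)
      - (if 0 < i \<and> i < j then 1 else 0) * ((if k = i then 1 else 0) * y k)" for k
    using dm by (auto simp: facet_coeff_def Let_def algebra_simps)
  then have "facet_ext n y (n + i * n + j) = 2 * (\<Sum>k<n. y k) - 3 * (\<Sum>k<n. (if k = j then 1 else 0) * y k)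
      - (if 0 < i \<and> i < j then 1 else 0) * (\<Sum>k<n. (if k = i then 1 else 0) * y k)"
    unfolding facet_ext_def by (simp only: sum_subtractf sum_distrib_left)
  then show ?thesis using ij sum_delta_mult[of "{..<n}" j y] sum_delta_mult[of "{..<n}" i y] by simp
qed

lemma facet_row_cases:
  fixes r n :: nat
  assumes "r < n + n * n"
  obtains "r < n" | i j where "i < n" "j < n" "r = n + i * n + j"
proof (cases "r < n")
  case False
  then have "0 < n" "(r - n) < n * n" using assms by (auto intro: Nat.gr0I)
  then have "(r - n) div n < n" "(r - n) mod n < n" by (simp_all add: less_mult_imp_div_less)
  moreover have "r = n + ((r - n) div n) * n + (r - n) mod n" using False by simp
  ultimately show ?thesis using that(2) by blast
qed (use that in blast)

lemma sum_ray_vec: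
  assumes "a < n" "b < n" "a \<noteq> b"
  shows "(\<Sum>k<n. ray_vec (a, b) k) = 3" "(\<Sum>k<n. ray_vec (a, b) k * ray_vec (a, b) k) = 5"
proof -
  have *: "(\<Sum>k<n. f k) = f a + f b" if "\<And>k. k \<noteq> a \<Longrightarrow> k \<noteq> b \<Longrightarrow> f k = 0" for f :: "nat \<Rightarrow> real"
    using assms that by (subst sum.mono_neutral_right[of "{..<n}" "{a, b}"]) auto
  show "(\<Sum>k<n. ray_vec (a, b) k) = 3" "(\<Sum>k<n. ray_vec (a, b) k * ray_vec (a, b) k) = 5"
    using assms(3) by (subst *; simp add: ray_vec_def)+
qed

lemma ray_indexD:
  assumes "(a, b) \<in> ray_index n"
  shows "a < n" "b < n" "a \<noteq> b" "\<not> (0 < b \<and> b < a)"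
  using assms by (auto simp: ray_index_def)

lemma ray_index_iff: "(a, b) \<in> ray_index n \<longleftrightarrow> a < n \<and> b < n \<and> a \<noteq> b \<and> \<not> (0 < b \<and> b < a)"
  by (auto simp: ray_index_def image_iff)

text \<open>The coordinates of a ray add up to 3, so a facet functional is
  \<open>6 - 3 * y j\<close>, possibly minus \<open>y i\<close>. It is negative only if
  \<open>y j\<close> is 2 and \<open>y i\<close> is 1 with \<open>0 < i < j\<close>, and
  \<open>ray_index\<close> omits that ray.\<close>

lemma facet_ext_ray_nonneg:
  assumes t: "t \<in> ray_index n" and r: "r < n + n * n"
  shows "0 \<le> facet_ext n (ray_vec t) r"
proof -
  obtain a b where ab: "t = (a, b)" by (cases t)
  have t': "a < n" "b < n" "a \<noteq> b" "\<not> (0 < b \<and> b < a)" using ray_indexD t ab by auto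
  from r show ?thesis
  proof (cases rule: facet_row_cases)
    case 1
    then show ?thesis by (simp add: facet_ext_low ray_vec_def)
  next
    case (2 i j)
    then show ?thesis
      using t' facet_ext_high[OF 2(1,2), of "ray_vec (a, b)"] sum_ray_vec(1)[OF t'(1-3)]
      by (auto simp: ab ray_vec_def)
  qed
qed

text \<open>Let \<open>y a\<close> be the largest entry, \<open>y b\<close> the largest of the
  others, and \<open>s\<close> and \<open>q\<close> the sum and the sum of squares without
  \<open>y a\<close>. Then \<open>q \<le> y b * s\<close>. If \<open>y a < s\<close>, the bound
  \<open>y b \<le> y a\<close> gives strict inequality; otherwise \<open>y b \<le> s\<close> is
  used, and equality forces \<open>y a = 2 * s\<close> and \<open>y b = s\<close>.\<close>

lemma facet_cone_form:
  fixes y :: "nat \<Rightarrow> real"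
  assumes n: "n \<ge> 2" and y: "\<And>k. k < n \<Longrightarrow> 0 \<le> y k" "\<And>k. k < n \<Longrightarrow> 3 * y k \<le> 2 * (\<Sum>k<n. y k)"
  shows "9 * (\<Sum>k<n. y k * y k) \<le> 5 * (\<Sum>k<n. y k)\<^sup>2"
    and "9 * (\<Sum>k<n. y k * y k) = 5 * (\<Sum>k<n. y k)\<^sup>2 \<Longrightarrow>
      \<exists>a b c. a < n \<and> b < n \<and> a \<noteq> b \<and> 0 \<le> c \<and> (\<forall>k<n. y k = c * ray_vec (a, b) k)"
proof -
  have argmax: "\<exists>a\<in>I. \<forall>k\<in>I. y k \<le> y a" if "finite I" "I \<noteq> {}" for I
  proof -
    have "Max (y ` I) \<in> y ` I" using that by (intro Max_in) auto
    then obtain a where "a \<in> I" "y a = Max (y ` I)" by auto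
    then show ?thesis using that by (intro bexI[of _ a]) auto
  qed
  obtain a where a: "a < n" "\<And>k. k < n \<Longrightarrow> y k \<le> y a"
    using argmax[of "{..<n}"] n by (auto simp: lessThan_empty_iff)
  define R where "R = {..<n} - {a}"
  have "(if a = 0 then 1 else 0) \<in> R" using n by (auto simp: R_def)
  then have "R \<noteq> {}" by blast
  then obtain b where b: "b \<in> R" "\<And>k. k \<in> R \<Longrightarrow> y k \<le> y b"
    using argmax[of R] by (auto simp: R_def)
  have bn: "b < n" "b \<noteq> a" using b by (auto simp: R_def)
  define s where "s = (\<Sum>k\<in>R. y k)"
  define q where "q = (\<Sum>k\<in>R. y k * y k)"
  have nn: "0 \<le> y k" if "k \<in> R" for k using that y by (auto simp: R_def)
  have S1: "(\<Sum>k<n. y k) = y a + s" and S2: "(\<Sum>k<n. y k * y k) = y a * y a + q"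
    unfolding s_def q_def R_def using a(1) by (auto intro: sum.remove)
  have "q \<le> (\<Sum>k\<in>R. y b * y k)"
    unfolding q_def using b nn by (intro sum_mono mult_right_mono) auto
  then have q: "q \<le> y b * s" by (simp add: s_def sum_distrib_left)
  have ybs: "y b \<le> s" unfolding s_def using nn b by (intro member_le_sum) (auto simp: R_def)
  have s0: "0 \<le> s" and a0: "0 \<le> y a" using nn y a by (auto simp: s_def sum_nonneg)
  have yba: "y b \<le> y a" using a bn by simp
  have a2s: "y a \<le> 2 * s" using y(2)[OF a(1)] S1 by simp
  \<comment> \<open>When \<open>s \<le> y a\<close>, both factors on the right are nonnegative, the
    second by the facet inequality at \<open>a\<close>.\<close>
  have low: "5 * (y a + s)\<^sup>2 - 9 * (y a * y a) - 9 * (s * s) = 2 * ((2 * y a - s) * (2 * s - y a))"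
    by (simp add: power2_eq_square algebra_simps)
  have case1: "9 * (y a * y a + q) < 5 * (y a + s)\<^sup>2" if "y a < s"
  proof -
    have "q \<le> y a * s" using q mult_right_mono[OF yba s0] by linarith
    moreover have "0 < 5 * (y a + s)\<^sup>2 - 9 * (y a * y a) - 9 * (y a * s)"
    proof -
      have "0 < (s - y a) * (5 * s + 4 * y a) + 2 * (y a * s)"
        using that a0 s0 by (intro add_pos_nonneg mult_pos_pos) auto
      also have "\<dots> = 5 * (y a + s)\<^sup>2 - 9 * (y a * y a) - 9 * (y a * s)"
        by (simp add: power2_eq_square algebra_simps)
      finally show ?thesis .
    qed
    ultimately show ?thesis by (simp add: distrib_left)
  qed
  have qs: "q \<le> s * s" using q mult_right_mono[OF ybs s0] by linarith
  have case2: "0 \<le> 2 * ((2 * y a - s) * (2 * s - y a))" if "s \<le> y a"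
    using that a2s a0 by simp
  show "9 * (\<Sum>k<n. y k * y k) \<le> 5 * (\<Sum>k<n. y k)\<^sup>2"
    unfolding S1 S2
  proof (cases "y a < s")
    case True
    then show "9 * (y a * y a + q) \<le> 5 * (y a + s)\<^sup>2" using case1 by simp
  next
    case False
    then have "0 \<le> 5 * (y a + s)\<^sup>2 - 9 * (y a * y a) - 9 * (s * s)" using case2 unfolding low by simp
    then show "9 * (y a * y a + q) \<le> 5 * (y a + s)\<^sup>2" using qs by (simp add: distrib_left)
  qed
  assume "9 * (\<Sum>k<n. y k * y k) = 5 * (\<Sum>k<n. y k)\<^sup>2"
  then have eq: "9 * (y a * y a + q) = 5 * (y a + s)\<^sup>2" unfolding S1 S2 .
  then have sa: "s \<le> y a" using case1 by force
  have W: "2 * ((2 * y a - s) * (2 * s - y a)) = 9 * q - 9 * (s * s)"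
    using eq unfolding low[symmetric] by (simp add: distrib_left)
  have "0 \<le> 9 * q - 9 * (s * s)" using case2[OF sa] unfolding W .
  then have qeq: "q = s * s" using qs by simp
  then have "(2 * y a - s) * (2 * s - y a) = 0" using W by simp
  \<comment> \<open>The other factor vanishes only if \<open>s\<close> and \<open>y a\<close> are
    both 0, which is covered as well.\<close>
  then have ya: "y a = 2 * s" using sa s0 by auto
  have "s * s \<le> y b * s" using q qeq by simp
  then have "s = 0 \<or> s \<le> y b" using s0 by (auto simp: mult_le_cancel_right)
  then have yb: "y b = s" using ybs nn[OF b(1)] by auto
  have "s = y b + (\<Sum>k\<in>R - {b}. y k)"
    unfolding s_def using b by (intro sum.remove) (auto simp: R_def)
  then have "(\<Sum>k\<in>R - {b}. y k) = 0" using yb by simp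
  then have "\<forall>k\<in>R - {b}. y k = 0"
    using nn by (subst (asm) sum_nonneg_eq_0_iff) (auto simp: R_def)
  then have "y k = s * ray_vec (a, b) k" if "k < n" for k
    using that ya yb bn by (auto simp: ray_vec_def R_def)
  then show "\<exists>a b c. a < n \<and> b < n \<and> a \<noteq> b \<and> 0 \<le> c \<and> (\<forall>k<n. y k = c * ray_vec (a, b) k)"
    using a(1) bn s0 by blast
qed

text \<open>The off-diagonal entry at \<open>(i, j)\<close> involves only the rays
  \<open>(i, j)\<close> and \<open>(j, i)\<close>, and for \<open>0 < i < j\<close> only the first
  is present. The coefficients of \<open>(0, j)\<close> and \<open>(j, 0)\<close> are separated by
  the diagonal entry at \<open>j\<close>, which weighs them 1 and 4.\<close>

lemma ray_vecs_independent:
  assumes zero: "\<And>i j. i < n \<Longrightarrow> j < n \<Longrightarrow> (\<Sum>t\<in>ray_index n. d t * (ray_vec t i * ray_vec t j)) = 0"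
    and t: "t \<in> ray_index n"
  shows "d t = 0"
proof -
  have off: "(\<Sum>t\<in>ray_index n \<inter> {(i, j), (j, i)}. d t) = 0" if ij: "i < n" "j < n" "i \<noteq> j" for i j
  proof -
    have "0 = (\<Sum>t\<in>ray_index n. d t * (ray_vec t i * ray_vec t j))" using zero ij by simp
    also have "\<dots> = (\<Sum>t\<in>ray_index n \<inter> {(i, j), (j, i)}. d t * 2)"
      using ij(3) finite_ray_index by (intro sum.mono_neutral_cong_right) (auto simp: ray_vec_def)
    also have "\<dots> = (\<Sum>t\<in>ray_index n \<inter> {(i, j), (j, i)}. d t) * 2"
      by (simp add: sum_distrib_right)
    finally show ?thesis by simp
  qed
  have d1: "d (i, j) = 0" if "0 < i" "i < j" "j < n" for i j
  proof -
    have "ray_index n \<inter> {(i, j), (j, i)} = {(i, j)}" using that by (auto simp: ray_index_iff)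
    then show ?thesis using off[of i j] that by simp
  qed
  have d2: "d (0, j) = 0 \<and> d (j, 0) = 0" if j: "0 < j" "j < n" for j
  proof -
    have mem: "(0, j) \<in> ray_index n" "(j, 0) \<in> ray_index n" using j by (auto simp: ray_index_iff)
    then have "ray_index n \<inter> {(0, j), (j, 0)} = {(0, j), (j, 0)}" by auto
    then have e1: "d (0, j) + d (j, 0) = 0" using off[of 0 j] j by simp
    have vanish: "d t * (ray_vec t j * ray_vec t j) = 0" if t: "t \<in> ray_index n - {(0, j), (j, 0)}" for t
    proof -
      obtain a b where ab: "t = (a, b)" by (cases t)
      then have "a < n" "b < n" "a \<noteq> b" "\<not> (0 < b \<and> b < a)" using t ray_indexD[of a b n] by auto
      then consider "0 < a" "a < b" "b < n" | "a = 0" "b \<noteq> j" | "b = 0" "a \<noteq> j"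
        using ab t by fastforce
      then show ?thesis using ab d1 j by cases (auto simp: ray_vec_def)
    qed
    have "0 = (\<Sum>t\<in>ray_index n. d t * (ray_vec t j * ray_vec t j))" using zero j by simp
    also have "\<dots> = (\<Sum>t\<in>{(0, j), (j, 0)}. d t * (ray_vec t j * ray_vec t j))"
      using mem vanish finite_ray_index by (intro sum.mono_neutral_right) auto
    also have "\<dots> = d (0, j) + d (j, 0) * 4" using j by (simp add: ray_vec_def)
    finally show ?thesis using e1 by simp
  qed
  obtain a b where ab: "t = (a, b)" by (cases t)
  then have "a < n" "b < n" "a \<noteq> b" "\<not> (0 < b \<and> b < a)" using t ray_indexD[of a b n] by auto
  then consider "0 < a" "a < b" "b < n" | "a = 0" "0 < b" "b < n" | "b = 0" "0 < a" "a < n"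
    by fastforce
  then show ?thesis using ab d1 d2 by cases auto
qed

section \<open>Decompositions of the constructed matrix\<close>

lemma ray_mat_cp_decomp:
  obtains h where "bij_betw h {..<card (ray_index n)} (ray_index n)"
    "cp_decomp (n + n * n) {..<card (ray_index n)} (\<lambda>l. facet_ext n (ray_vec (h l))) (ray_mat n)"
proof -
  obtain h where h: "bij_betw h {..<card (ray_index n)} (ray_index n)"
    using ex_bij_betw_nat_finite[OF finite_ray_index[of n]] atLeast0LessThan by auto
  have "ray_mat n i j = (\<Sum>l<card (ray_index n). facet_ext n (ray_vec (h l)) i * facet_ext n (ray_vec (h l)) j)" for i j
    unfolding ray_mat_def
    using sum.reindex_bij_betw[OF h, of "\<lambda>t. facet_ext n (ray_vec t) i * facet_ext n (ray_vec t) j"] by simp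
  moreover have "0 \<le> facet_ext n (ray_vec (h l)) i" if "l < card (ray_index n)" "i < n + n * n" for l i
    using facet_ext_ray_nonneg[OF _ that(2)] bij_betwE[OF h] that(1) by blast
  ultimately have "cp_decomp (n + n * n) {..<card (ray_index n)} (\<lambda>l. facet_ext n (ray_vec (h l))) (ray_mat n)"
    unfolding cp_decomp_def by simp
  then show ?thesis using that h by blast
qed

text \<open>All rows are combinations of the first \<open>n\<close>. This bounds the rank and forces
  every vector of a decomposition to be the facet extension of its first \<open>n\<close>
  entries.\<close>

lemma ray_mat_row_relation: "ray_mat n r s = (\<Sum>k<n. facet_coeff n r k * ray_mat n k s)"
proof -
  have "ray_mat n r s = (\<Sum>t\<in>ray_index n. \<Sum>k<n. facet_coeff n r k * (ray_vec t k * facet_ext n (ray_vec t) s))"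
    unfolding ray_mat_def facet_ext_def[of n _ r] sum_distrib_right by (simp add: mult.assoc)
  also have "\<dots> = (\<Sum>k<n. \<Sum>t\<in>ray_index n. facet_coeff n r k * (ray_vec t k * facet_ext n (ray_vec t) s))"
    by (rule sum.swap)
  also have "\<dots> = (\<Sum>k<n. facet_coeff n r k * ray_mat n k s)"
    unfolding ray_mat_def by (intro sum.cong refl) (simp add: facet_ext_low sum_distrib_left)
  finally show ?thesis .
qed

lemma cp_decomp_mono: "cp_decomp n L v A \<Longrightarrow> m \<le> n \<Longrightarrow> cp_decomp m L v A"
  by (simp add: cp_decomp_def)

text \<open>Nonnegativity of the later entries of a vector amounts to the facet inequalities for its
  first \<open>n\<close> entries. The form is then nonnegative on each vector, while its sum over
  the decomposition is 0, as it is for the rays.\<close>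

lemma ray_mat_decomp_rays:
  assumes n: "n \<ge> 2" and dec: "cp_decomp (n + n * n) L v (ray_mat n)" and l: "l \<in> L"
  shows "\<exists>t\<in>ray_index n. \<exists>c. \<forall>k<n. v l k = c * ray_vec t k"
proof -
  define S :: "nat \<Rightarrow> nat \<Rightarrow> real" where "S = (\<lambda>i j. 5 - 9 * (if j = i then 1 else 0))"
  have bilin_S: "bilin n S y y = 5 * (\<Sum>k<n. y k)\<^sup>2 - 9 * (\<Sum>k<n. y k * y k)" for y
  proof -
    have inner: "(\<Sum>j<n. S i j * y j) = 5 * (\<Sum>k<n. y k) - 9 * y i" if "i < n" for i
    proof -
      have "(\<Sum>j<n. S i j * y j) = (\<Sum>j<n. 5 * y j - 9 * ((if j = i then 1 else 0) * y j))"
        by (intro sum.cong refl) (simp add: S_def algebra_simps)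
      also have "\<dots> = 5 * (\<Sum>j<n. y j) - 9 * (\<Sum>j<n. (if j = i then 1 else 0) * y j)"
        by (simp only: sum_subtractf sum_distrib_left)
      also have "(\<Sum>j<n. (if j = i then 1 else 0) * y j) = y i"
        using that by (intro sum_delta_mult) auto
      finally show ?thesis .
    qed
    have "bilin n S y y = (\<Sum>i<n. (5 * (\<Sum>k<n. y k)) * y i - 9 * (y i * y i))"
      unfolding bilin_def by (intro sum.cong refl) (subst inner, auto simp: algebra_simps)
    also have "\<dots> = (5 * (\<Sum>k<n. y k)) * (\<Sum>i<n. y i) - 9 * (\<Sum>i<n. y i * y i)"
      by (simp only: sum_subtractf sum_distrib_left)
    finally show ?thesis by (simp add: power2_eq_square)
  qed
  have v0: "0 \<le> v l k" if "l \<in> L" "k < n" for l k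
    using cp_decompD(2)[OF dec that(1)] that(2) by simp
  have facet: "0 \<le> 2 * (\<Sum>k<n. v l k) - 3 * v l j - (if 0 < i \<and> i < j then v l i else 0)"
    if l: "l \<in> L" and ij: "i < n" "j < n" for l i j
  proof -
    have "(i + 1) * n \<le> n * n" using ij by (intro mult_right_mono) auto
    then have r: "n + i * n + j < n + n * n" using ij by (simp add: algebra_simps)
    have "v l (n + i * n + j) = (\<Sum>k\<in>{..<n}. facet_coeff n (n + i * n + j) k * v l k)"
      by (rule cp_decomp_row_relation[OF dec r _ ray_mat_row_relation l]) auto
    then have "v l (n + i * n + j) = facet_ext n (v l) (n + i * n + j)" by (simp add: facet_ext_def)
    then show ?thesis using cp_decompD(2)[OF dec l r] facet_ext_high[OF ij] by simp
  qed
  \<comment> \<open>Taking \<open>i = j\<close> switches off the sharpening term.\<close>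
  have facet': "3 * v l j \<le> 2 * (\<Sum>k<n. v l k)" if "l \<in> L" "j < n" for l j
    using facet[OF that(1) _ that(2), of j] that by simp
  obtain h where h: "bij_betw h {..<card (ray_index n)} (ray_index n)"
    and dT: "cp_decomp (n + n * n) {..<card (ray_index n)} (\<lambda>l. facet_ext n (ray_vec (h l))) (ray_mat n)"
    by (rule ray_mat_cp_decomp)
  have ray0: "bilin n S (facet_ext n (ray_vec t)) (facet_ext n (ray_vec t)) = 0" if "t \<in> ray_index n" for t
  proof -
    obtain a b where ab: "t = (a, b)" by (cases t)
    then have "a < n" "b < n" "a \<noteq> b" using ray_indexD that by auto
    then show ?thesis unfolding bilin_S using sum_ray_vec ab by (simp add: facet_ext_low)
  qed
  \<comment> \<open>The sum is the trace product of \<open>S\<close> with the matrix, so it can be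
    evaluated on the decomposition into rays.\<close>
  have "(\<Sum>l\<in>L. bilin n S (v l) (v l)) = (\<Sum>i<n. \<Sum>j<n. S i j * ray_mat n i j)"
    by (rule sum_bilin_decomp[OF cp_decomp_mono[OF dec]]) simp
  also have "\<dots> = (\<Sum>l<card (ray_index n). bilin n S (facet_ext n (ray_vec (h l))) (facet_ext n (ray_vec (h l))))"
    by (rule sum_bilin_decomp[symmetric, OF cp_decomp_mono[OF dT]]) simp
  also have "\<dots> = 0" using ray0 bij_betwE[OF h] by (intro sum.neutral) auto
  finally have "(\<Sum>l\<in>L. bilin n S (v l) (v l)) = 0" .
  moreover have "0 \<le> bilin n S (v l) (v l)" if "l \<in> L" for l
    unfolding bilin_S using facet_cone_form(1)[OF n v0[OF that] facet'[OF that]] by simp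
  ultimately have "bilin n S (v l) (v l) = 0"
    using l cp_decompD(1)[OF dec] by (subst (asm) sum_nonneg_eq_0_iff) auto
  then have "9 * (\<Sum>k<n. v l k * v l k) = 5 * (\<Sum>k<n. v l k)\<^sup>2" unfolding bilin_S by simp
  then obtain a b c where abc: "a < n" "b < n" "a \<noteq> b" "0 \<le> c" "\<forall>k<n. v l k = c * ray_vec (a, b) k"
    using facet_cone_form(2)[OF n v0[OF l] facet'[OF l]] by blast
  show ?thesis
  proof (cases "(a, b) \<in> ray_index n")
    case True
    then show ?thesis using abc(5) by blast
  next
    case False
    then have ba: "0 < b" "b < a" using abc by (auto simp: ray_index_iff)
    have "(\<Sum>k<n. v l k) = (\<Sum>k<n. c * ray_vec (a, b) k)" using abc(5) by (intro sum.cong) auto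
    also have "\<dots> = 3 * c" using sum_ray_vec(1)[OF abc(1-3)] by (simp flip: sum_distrib_left)
    \<comment> \<open>The sharpened facet inequality with indices \<open>b\<close> and
      \<open>a\<close> reads \<open>6 * c - 6 * c - c \<ge> 0\<close>. The vector is therefore 0, a
      trivial multiple of the ray \<open>(0, 1)\<close>.\<close>
    finally have "c \<le> 0"
      using facet[OF l abc(2,1)] ba abc by (simp add: ray_vec_def)
    then have "\<forall>k<n. v l k = 0 * ray_vec (0, 1) k" using abc(4,5) by simp
    moreover have "(0, 1) \<in> ray_index n" using n by (simp add: ray_index_iff)
    ultimately show ?thesis by blast
  qed
qed

text \<open>Grouping the vectors by ray and adding the squares of their multipliers gives a weight
  for each ray. By independence all weights are 1, so every ray must occur.\<close>

lemma ray_mat_decomp_card: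
  assumes n: "n \<ge> 2" and dec: "cp_decomp (n + n * n) L v (ray_mat n)"
  shows "card (ray_index n) \<le> card L"
proof -
  have fin: "finite L" using dec by (rule cp_decompD)
  obtain \<tau> c where \<tau>: "\<And>l. l \<in> L \<Longrightarrow> \<tau> l \<in> ray_index n"
    and c: "\<And>l k. l \<in> L \<Longrightarrow> k < n \<Longrightarrow> v l k = c l * ray_vec (\<tau> l) k"
    using ray_mat_decomp_rays[OF n dec] by metis
  define C where "C = (\<lambda>t. \<Sum>l | l \<in> L \<and> \<tau> l = t. (c l)\<^sup>2)"
  have "(\<Sum>t\<in>ray_index n. (C t - 1) * (ray_vec t i * ray_vec t j)) = 0" if ij: "i < n" "j < n" for i j
  proof -
    have "(\<Sum>t\<in>ray_index n. ray_vec t i * ray_vec t j) = ray_mat n i j"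
      using ij by (simp add: ray_mat_def facet_ext_low)
    also have "\<dots> = (\<Sum>l\<in>L. v l i * v l j)" using ij by (intro cp_decompD(3)[OF dec]) auto
    also have "\<dots> = (\<Sum>l\<in>L. (c l)\<^sup>2 * (ray_vec (\<tau> l) i * ray_vec (\<tau> l) j))"
      using c ij by (intro sum.cong refl) (simp add: power2_eq_square algebra_simps)
    also have "\<dots> = (\<Sum>t\<in>ray_index n. \<Sum>l | l \<in> L \<and> \<tau> l = t. (c l)\<^sup>2 * (ray_vec (\<tau> l) i * ray_vec (\<tau> l) j))"
      using \<tau> by (intro sum.group[symmetric] fin finite_ray_index) auto
    also have "\<dots> = (\<Sum>t\<in>ray_index n. C t * (ray_vec t i * ray_vec t j))"
      unfolding C_def sum_distrib_right by (intro sum.cong refl) auto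
    finally show ?thesis by (simp add: left_diff_distrib sum_subtractf)
  qed
  then have C1: "C t = 1" if "t \<in> ray_index n" for t
    using ray_vecs_independent[of n "\<lambda>t. C t - 1" t] that by simp
  have "ray_index n \<subseteq> \<tau> ` L"
  proof
    fix t assume "t \<in> ray_index n"
    then have "{l \<in> L. \<tau> l = t} \<noteq> {}" using C1[of t] by (force simp: C_def)
    then show "t \<in> \<tau> ` L" by blast
  qed
  then show ?thesis using fin by (meson card_image_le card_mono finite_imageI le_trans)
qed

section \<open>Rank and cp-rank\<close>

context vec_space
begin

lemma rank_eq_cardI:
  assumes A: "A \<in> carrier_mat n nc" and J: "J \<subseteq> {..<nc}"
    and indep: "\<And>x. (\<And>r. r < n \<Longrightarrow> (\<Sum>j\<in>J. x j * A $$ (r, j)) = 0) \<Longrightarrow> (\<And>j. j \<in> J \<Longrightarrow> x j = 0)"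
    and span: "\<And>i. i < nc \<Longrightarrow> \<exists>a. \<forall>r<n. A $$ (r, i) = (\<Sum>j\<in>J. a j * A $$ (r, j))"
  shows "rank A = card J"
proof -
  have finJ: "finite J" using J finite_subset by blast
  have idx: "col A j $ r = A $$ (r, j)" if "j < nc" "r < n" for j r using A that by simp
  \<comment> \<open>Two equal columns would give the nontrivial relation \<open>e_i - e_j\<close>.
    So the set of columns has as many elements as \<open>J\<close>.\<close>
  have inj: "inj_on (col A) J"
  proof (rule inj_onI, rule ccontr)
    fix i j assume ij: "i \<in> J" "j \<in> J" "col A i = col A j" "i \<noteq> j"
    let ?x = "\<lambda>k. (if k = i then 1 else 0) - (if k = j then 1 else 0) :: 'a"
    have "(\<Sum>k\<in>J. ?x k * A $$ (r, k)) = 0" if r: "r < n" for r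
    proof -
      have "(\<Sum>k\<in>J. ?x k * A $$ (r, k)) = A $$ (r, i) - A $$ (r, j)"
        using finJ ij sum_delta_mult[of J i "\<lambda>k. A $$ (r, k)"] sum_delta_mult[of J j "\<lambda>k. A $$ (r, k)"]
        by (simp add: left_diff_distrib sum_subtractf)
      also have "\<dots> = col A i $ r - col A j $ r"
        using ij(1,2) J idx[of i r] idx[of j r] r by (simp only: subset_iff lessThan_iff)
      finally show ?thesis using ij(3) by simp
    qed
    from indep[OF this ij(1)] ij(4) show False by simp
  qed
  define U where "U = col A ` J"
  have finU: "finite U" using finJ by (simp add: U_def)
  have UV: "U \<subseteq> carrier_vec n" using A J by (auto simp: U_def)
  have lc: "lincomb a U $ r = (\<Sum>j\<in>J. a (col A j) * A $$ (r, j))" if "r < n" for a r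
  proof -
    have "lincomb a U $ r = (\<Sum>u\<in>U. a u * u $ r)" by (rule lincomb_index[OF that UV])
    also have "\<dots> = (\<Sum>j\<in>J. a (col A j) * col A j $ r)"
      unfolding U_def by (simp add: sum.reindex[OF inj])
    also have "\<dots> = (\<Sum>j\<in>J. a (col A j) * A $$ (r, j))"
      using J that by (intro sum.cong) (auto simp: idx)
    finally show ?thesis .
  qed
  have li: "lin_indpt U"
  proof (rule finite_lin_indpt2[OF finU])
    show "U \<subseteq> carrier_vec n" by (rule UV)
    fix a assume "lincomb a U = 0\<^sub>v n"
    then have "(\<Sum>j\<in>J. a (col A j) * A $$ (r, j)) = 0" if "r < n" for r
      using lc[OF that, of a] that by simp
    from indep[OF this] show "\<forall>v\<in>U. a v = 0" by (auto simp: U_def)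
  qed
  have colspan: "col A i \<in> span U" if i: "i < nc" for i
  proof -
    obtain a where a: "\<And>r. r < n \<Longrightarrow> A $$ (r, i) = (\<Sum>j\<in>J. a j * A $$ (r, j))" using span[OF i] by blast
    define b where "b = (\<lambda>u. a (the_inv_into J (col A) u))"
    have "lincomb b U = col A i"
    proof (rule eq_vecI)
      show "dim_vec (lincomb b U) = dim_vec (col A i)" using lincomb_dim[OF finU UV] A by simp
      fix r assume "r < dim_vec (col A i)"
      then have r: "r < n" using A by simp
      have "lincomb b U $ r = (\<Sum>j\<in>J. a j * A $$ (r, j))"
        unfolding lc[OF r] by (intro sum.cong refl) (simp add: b_def the_inv_into_f_f[OF inj])
      then show "lincomb b U $ r = col A i $ r" using a[OF r] idx[OF i r] by simp
    qed
    from this[symmetric] show ?thesis unfolding finite_span[OF finU UV] by (intro CollectI exI)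
  qed
  have cols: "set (cols A) = col A ` {..<nc}" using A by (auto simp: cols_def)
  \<comment> \<open>Any further column lies in the span of \<open>U\<close>, so adding it destroys
    independence.\<close>
  have "maximal U (\<lambda>T. T \<subseteq> set (cols A) \<and> lin_indpt T)"
    unfolding maximal_def
  proof (intro conjI allI impI)
    show "U \<subseteq> set (cols A)" unfolding U_def cols using J by (rule image_mono)
    show "lin_indpt U" by (rule li)
    fix B assume B: "U \<subseteq> B \<and> B \<subseteq> set (cols A) \<and> lin_indpt B"
    show "B = U"
    proof (rule ccontr)
      assume "B \<noteq> U"
      then obtain x where x: "x \<in> B" "x \<notin> U" using B by blast
      then obtain i where i: "i < nc" "x = col A i" using B unfolding cols by blast
      have "x \<in> carrier_vec n" unfolding i(2) using A i(1) by (intro col_carrier_vec)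
      then have "lin_dep (U \<union> {x})"
        using lin_dep_iff_in_span[of U x] li x(2) UV colspan[OF i(1)] i(2) by simp
      moreover have "U \<union> {x} \<subseteq> B" using B x by blast
      ultimately have "lin_dep B" using subset_li_is_li by blast
      then show False using B by blast
    qed
  qed
  then have "rank A = card U" by (rule rank_card_indpt[OF A])
  then show ?thesis by (simp add: U_def card_image[OF inj])
qed

text \<open>A maximal independent set of columns spans all of them; \<open>J\<close> selects one
  index for each of its members.\<close>

lemma rank_spanning_cols:
  assumes A: "A \<in> carrier_mat n nc"
  shows "\<exists>J. J \<subseteq> {..<nc} \<and> card J = rank A \<and>
    (\<forall>i<nc. \<exists>a. \<forall>r<n. A $$ (r, i) = (\<Sum>j\<in>J. a j * A $$ (r, j)))"
proof -
  have "\<exists>U. finite U \<and> maximal U (\<lambda>T. T \<subseteq> set (cols A) \<and> lin_indpt T) \<and> {} \<subseteq> U"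
    by (rule maximal_exists_superset[of "set (cols A)"]) (auto simp: lin_dep_def)
  then obtain U where U: "finite U" "maximal U (\<lambda>T. T \<subseteq> set (cols A) \<and> lin_indpt T)" by blast
  have rank: "rank A = card U" by (rule rank_card_indpt[OF A U(2)])
  have Uc: "U \<subseteq> set (cols A)" and li: "lin_indpt U" using U(2) by (auto simp: maximal_def)
  have cols: "set (cols A) = col A ` {..<nc}" using A by (auto simp: cols_def)
  have UV: "U \<subseteq> carrier_vec n" using Uc cols A by auto
  obtain J where J: "J \<subseteq> {..<nc}" "U = col A ` J" "inj_on (col A) J"
    using Uc unfolding cols by (meson subset_image_inj)
  have "\<exists>a. \<forall>r<n. A $$ (r, i) = (\<Sum>j\<in>J. a j * A $$ (r, j))" if i: "i < nc" for i
  proof -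
    have cV: "col A i \<in> carrier_vec n" using A i by auto
    have "col A i \<in> span U"
    proof (cases "col A i \<in> U")
      case True
      then show ?thesis using in_own_span[of U] UV by auto
    next
      case False
      have "lin_dep (U \<union> {col A i})"
      proof (rule ccontr)
        assume "lin_indpt (U \<union> {col A i})"
        moreover have "U \<union> {col A i} \<subseteq> set (cols A)" using Uc i cols by auto
        ultimately have "U \<union> {col A i} = U" using U(2) unfolding maximal_def by blast
        then show False using False by blast
      qed
      then show ?thesis using lin_dep_iff_in_span[of U "col A i"] UV li cV False by simp
    qed
    then obtain b where b: "lincomb b U = col A i"
      using finite_in_span[OF U(1), of "col A i"] UV by auto
    have "A $$ (r, i) = (\<Sum>j\<in>J. b (col A j) * A $$ (r, j))" if r: "r < n" for r
    proof -
      have "A $$ (r, i) = lincomb b U $ r" using b A i r by simp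
      also have "\<dots> = (\<Sum>u\<in>U. b u * u $ r)" by (rule lincomb_index[OF r UV])
      also have "\<dots> = (\<Sum>j\<in>J. b (col A j) * col A j $ r)"
        unfolding J(2) by (simp add: sum.reindex[OF J(3)])
      also have "\<dots> = (\<Sum>j\<in>J. b (col A j) * A $$ (r, j))"
        using A J(1) r by (intro sum.cong) auto
      finally show ?thesis .
    qed
    then show ?thesis by (intro exI[of _ "\<lambda>j. b (col A j)"]) simp
  qed
  moreover have "card J = rank A" unfolding rank J(2) by (simp add: card_image[OF J(3)])
  ultimately show ?thesis using J(1) by blast
qed

end

text \<open>This makes the set in \<open>b_max\<close> finite although the order is arbitrary.
  Symmetry turns the relations between columns into relations between rows.\<close>

lemma cp_rank_le_of_rank:
  assumes M: "M \<in> cp_cone m"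
  shows "cp_rank M \<le> vec_space.rank m M * (vec_space.rank m M + 1) div 2"
proof -
  have c: "M \<in> carrier_mat m m" and ex: "\<exists>k. cp_le m k (\<lambda>i j. M $$ (i, j))"
    using M by (auto simp: cp_cone_iff_cp_le)
  obtain k where k: "cp_le m k (\<lambda>i j. M $$ (i, j))" using ex by blast
  obtain L v where dec: "cp_decomp m L v (\<lambda>i j. M $$ (i, j))" using k by (auto simp: cp_le_def)
  have sym: "M $$ (i, j) = M $$ (j, i)" if "i < m" "j < m" for i j
    using cp_decompD(3)[OF dec that] cp_decompD(3)[OF dec that(2,1)] by (simp add: mult.commute)
  obtain J where J: "J \<subseteq> {..<m}" "card J = vec_space.rank m M"
    and span: "\<And>i. i < m \<Longrightarrow> \<exists>a. \<forall>r<m. M $$ (r, i) = (\<Sum>j\<in>J. a j * M $$ (r, j))"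
    using vec_space.rank_spanning_cols[OF c] by blast
  have "cp_le m (card J * (card J + 1) div 2) (\<lambda>i j. M $$ (i, j))"
  proof (rule cp_le_spanning_rows[OF k J(1)])
    fix i assume i: "i < m"
    obtain a where a: "\<And>r. r < m \<Longrightarrow> M $$ (r, i) = (\<Sum>j\<in>J. a j * M $$ (r, j))"
      using span[OF i] by blast
    have "M $$ (i, r) = (\<Sum>j\<in>J. a j * M $$ (j, r))" if "r < m" for r
    proof -
      have "M $$ (i, r) = (\<Sum>j\<in>J. a j * M $$ (r, j))" using sym[OF i that] a[OF that] by simp
      also have "\<dots> = (\<Sum>j\<in>J. a j * M $$ (j, r))" using sym J(1) that by (intro sum.cong) auto
      finally show ?thesis .
    qed
    then show "\<exists>a. \<forall>r<m. M $$ (i, r) = (\<Sum>j\<in>J. a j * M $$ (j, r))" by blast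
  qed
  then show ?thesis unfolding cp_rank_le_iff[OF M] J(2) .
qed

text \<open>The quadratic form of the leading block at \<open>x\<close> is a sum of squares, so
  \<open>x\<close> is orthogonal to all rays. The rays \<open>(0, j)\<close> and
  \<open>(j, 0)\<close> then give \<open>x 0 = x j = 0\<close>.\<close>

lemma ray_mat_nonsingular:
  assumes n: "n \<ge> 2" and x: "\<And>r. r < n \<Longrightarrow> (\<Sum>j<n. x j * ray_mat n r j) = 0" and k: "k < n"
  shows "x k = 0"
proof -
  define p where "p = (\<lambda>t. \<Sum>j<n. x j * ray_vec t j)"
  have "0 = (\<Sum>r<n. x r * (\<Sum>j<n. x j * ray_mat n r j))" using x by simp
  also have "\<dots> = (\<Sum>r<n. \<Sum>j<n. \<Sum>t\<in>ray_index n. (x r * ray_vec t r) * (x j * ray_vec t j))"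
    unfolding sum_distrib_left ray_mat_def
    by (intro sum.cong refl) (simp add: facet_ext_low algebra_simps)
  also have "\<dots> = (\<Sum>r<n. \<Sum>t\<in>ray_index n. \<Sum>j<n. (x r * ray_vec t r) * (x j * ray_vec t j))"
    by (rule sum.cong[OF refl]) (rule sum.swap)
  also have "\<dots> = (\<Sum>t\<in>ray_index n. \<Sum>r<n. \<Sum>j<n. (x r * ray_vec t r) * (x j * ray_vec t j))"
    by (rule sum.swap)
  also have "\<dots> = (\<Sum>t\<in>ray_index n. p t * p t)" by (simp add: p_def sum_product)
  finally have "(\<Sum>t\<in>ray_index n. p t * p t) = 0" by simp
  then have p0: "p t = 0" if "t \<in> ray_index n" for t
    using that finite_ray_index by (subst (asm) sum_nonneg_eq_0_iff) auto
  have p: "p (a, b) = 2 * x a + x b" if "a < n" "b < n" "a \<noteq> b" for a b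
    unfolding p_def using that
    by (subst sum.mono_neutral_right[of "{..<n}" "{a, b}"]) (auto simp: ray_vec_def)
  have both: "x 0 = 0 \<and> x j = 0" if "0 < j" "j < n" for j
  proof -
    have "2 * x 0 + x j = 0" "2 * x j + x 0 = 0"
      using that p[of 0 j] p[of j 0] p0[of "(0, j)"] p0[of "(j, 0)"] by (auto simp: ray_index_iff)
    then show ?thesis by linarith
  qed
  show ?thesis using both[of 1] both[of k] n k by (cases "k = 0") auto
qed

lemma ray_mat_rank_and_cp_rank:
  fixes n :: nat
  assumes n: "n \<ge> 2"
  defines "m \<equiv> n + n * n"
  defines "M \<equiv> mat m m (\<lambda>(i, j). ray_mat n i j)"
  shows "M \<in> cp_cone m" "vec_space.rank m M = n" "n * (n + 1) div 2 - 1 \<le> cp_rank M"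
proof -
  have c: "M \<in> carrier_mat m m" by (simp add: M_def)
  have idx: "M $$ (i, j) = ray_mat n i j" if "i < m" "j < m" for i j using that by (simp add: M_def)
  have eq: "cp_le m k (\<lambda>i j. M $$ (i, j)) \<longleftrightarrow> cp_le m k (ray_mat n)" for k
    by (rule cp_le_cong) (simp add: idx)
  have nm: "n \<le> m" by (simp add: m_def)
  obtain h where "cp_decomp m {..<card (ray_index n)} (\<lambda>l. facet_ext n (ray_vec (h l))) (ray_mat n)"
    using ray_mat_cp_decomp[of n] unfolding m_def by blast
  then show cone: "M \<in> cp_cone m"
    unfolding cp_cone_iff_cp_le eq using c by (auto simp: cp_le_def)
  show "n * (n + 1) div 2 - 1 \<le> cp_rank M"
  proof -
    have "cp_le m (cp_rank M) (ray_mat n)" using cp_rank_le_iff[OF cone, of "cp_rank M"] eq by simp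
    then obtain L v where "cp_decomp m L v (ray_mat n)" "card L \<le> cp_rank M" by (auto simp: cp_le_def)
    then have "card (ray_index n) \<le> cp_rank M"
      using ray_mat_decomp_card[OF n, of L v] unfolding m_def by simp
    then show ?thesis using card_ray_index[of n] n by simp
  qed
  have sym: "ray_mat n i j = ray_mat n j i" for i j by (simp add: ray_mat_def mult.commute)
  have "vec_space.rank m M = card {..<n}"
  proof (rule vec_space.rank_eq_cardI[OF c])
    show "{..<n} \<subseteq> {..<m}" using nm by auto
    fix x j assume x: "\<And>r. r < m \<Longrightarrow> (\<Sum>j<n. x j * M $$ (r, j)) = 0" and j: "j \<in> {..<n}"
    have "(\<Sum>j<n. x j * ray_mat n r j) = 0" if "r < n" for r
      using x[of r] that nm by (simp add: idx)
    then show "x j = 0" using ray_mat_nonsingular[OF n] j by blast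
  next
    fix i assume i: "i < m"
    have "M $$ (r, i) = (\<Sum>j<n. facet_coeff n i j * M $$ (r, j))" if r: "r < m" for r
    proof -
      have "M $$ (r, i) = ray_mat n i r" using r i by (simp add: idx sym)
      also have "\<dots> = (\<Sum>j<n. facet_coeff n i j * ray_mat n j r)" by (rule ray_mat_row_relation)
      also have "\<dots> = (\<Sum>j<n. facet_coeff n i j * M $$ (r, j))"
        using r nm by (intro sum.cong refl) (simp add: idx sym)
      finally show ?thesis .
    qed
    then show "\<exists>a. \<forall>r<m. M $$ (r, i) = (\<Sum>j\<in>{..<n}. a j * M $$ (r, j))" by blast
  qed
  then show "vec_space.rank m M = n" by simp
qed

lemma b_max_ge:
  assumes n: "n \<ge> 2"
  shows "n * (n + 1) div 2 - 1 \<le> b_max n"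
proof -
  let ?B = "{cp_rank M | M m. M \<in> cp_cone m \<and> vec_space.rank m M = n}"
  have "?B \<subseteq> {..n * (n + 1) div 2}" using cp_rank_le_of_rank by fastforce
  then have fin: "finite ?B" using finite_subset by blast
  obtain M m where M: "M \<in> cp_cone m" "vec_space.rank m M = n" "n * (n + 1) div 2 - 1 \<le> cp_rank M"
    using ray_mat_rank_and_cp_rank[OF n] by blast
  then have "cp_rank M \<le> b_max n" unfolding b_max_def by (intro Max_ge[OF fin]) blast
  then show ?thesis using M(3) by linarith
qed

section \<open>The bounds for the boundary and for the whole cone\<close>

lemma sym_mats_iff: "M \<in> sym_mats n \<longleftrightarrow> M \<in> carrier_mat n n \<and> symmetric n (\<lambda>i j. M $$ (i, j))"
proof
  assume "M \<in> sym_mats n"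
  then have c: "M \<in> carrier_mat n n" and t: "transpose_mat M = M" by (auto simp: sym_mats_def)
  have "M $$ (i, j) = M $$ (j, i)" if "i < n" "j < n" for i j
    using index_transpose_mat(1)[of i M j] c t that by auto
  then show "M \<in> carrier_mat n n \<and> symmetric n (\<lambda>i j. M $$ (i, j))"
    using c by (simp add: symmetric_def)
next
  assume M: "M \<in> carrier_mat n n \<and> symmetric n (\<lambda>i j. M $$ (i, j))"
  then have "transpose_mat M = M"
    by (intro eq_matI) (auto simp: symmetric_def)
  then show "M \<in> sym_mats n" using M by (simp add: sym_mats_def)
qed

lemma cp_cone_subset_sym_mats: "cp_cone n \<subseteq> sym_mats n"
  using cp_le_imp_symmetric by (auto simp: cp_cone_iff_cp_le sym_mats_iff)

lemma abs_entry_le_frobenius_dist: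
  assumes "i < n" "j < n"
  shows "\<bar>A $$ (i, j) - B $$ (i, j)\<bar> \<le> frobenius_dist n A B"
proof -
  have "norm (A $$ (i, j) - B $$ (i, j)) \<le> L2_set (\<lambda>p. \<bar>case p of (i, j) \<Rightarrow> A $$ (i, j) - B $$ (i, j)\<bar>) ({..<n} \<times> {..<n})"
    using member_le_L2_set[of "{..<n} \<times> {..<n}" "(i, j)" "\<lambda>p. \<bar>case p of (i, j) \<Rightarrow> A $$ (i, j) - B $$ (i, j)\<bar>"] assms
    by simp
  then show ?thesis by (simp add: frobenius_dist_def L2_set_def case_prod_unfold)
qed

lemma bd_cp_cone_iff:
  "M \<in> bd_cp_cone n \<longleftrightarrow> M \<in> sym_mats n \<and>
    (\<forall>e>0. \<exists>B\<in>cp_cone n. frobenius_dist n M B < e) \<and>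
    (\<forall>e>0. \<exists>X\<in>sym_mats n. X \<notin> cp_cone n \<and> frobenius_dist n M X < e)"
proof -
  interpret Metric_space "sym_mats n" "frobenius_dist n" by (rule Metric_space_sym_mats)
  show ?thesis
    unfolding bd_cp_cone_def sym_topology_def frontier_of_def metric_closure_of metric_interior_of
    using cp_cone_subset_sym_mats[of n] by (auto simp: subset_iff)
qed

lemma bd_cp_cone_positive_cp_le:
  assumes n: "n \<ge> 5" and M: "M \<in> bd_cp_cone n" and pos: "\<And>i j. i < n \<Longrightarrow> j < n \<Longrightarrow> M $$ (i, j) > 0"
  shows "M \<in> cp_cone n" "cp_le n (n * (n + 1) div 2 - 5) (\<lambda>i j. M $$ (i, j))"
proof -
  have M': "M \<in> sym_mats n" "\<And>e. e > 0 \<Longrightarrow> \<exists>B\<in>cp_cone n. frobenius_dist n M B < e"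
    "\<And>e. e > 0 \<Longrightarrow> \<exists>X\<in>sym_mats n. X \<notin> cp_cone n \<and> frobenius_dist n M X < e"
    using M unfolding bd_cp_cone_iff by blast+
  have near: "\<bar>X $$ (i, j) - M $$ (i, j)\<bar> < e" if "frobenius_dist n M X < e" "i < n" "j < n" for X e i j
    using abs_entry_le_frobenius_dist[OF that(2,3), of M X] that(1) by linarith
  \<comment> \<open>A boundary matrix is a limit of completely positive ones, all with at most
    \<open>N\<close> vectors, so it lies in the cone itself.\<close>
  have cp: "cp_le n (n * (n + 1) div 2) (\<lambda>i j. M $$ (i, j))"
  proof (rule cp_le_closed_approx)
    fix e :: real assume "e > 0"
    then obtain B where B: "B \<in> cp_cone n" "frobenius_dist n M B < e" using M'(2) by blast
    then have "cp_le n (n * (n + 1) div 2) (\<lambda>i j. B $$ (i, j))"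
      using cp_le_binomial by (auto simp: cp_cone_iff_cp_le)
    then show "\<exists>B. cp_le n (n * (n + 1) div 2) B \<and> (\<forall>i<n. \<forall>j<n. \<bar>B i j - M $$ (i, j)\<bar> < e)"
      using near[OF B(2)] by (intro exI[of _ "\<lambda>i j. B $$ (i, j)"]) simp
  qed
  then show "M \<in> cp_cone n" using M'(1) by (auto simp: cp_cone_iff_cp_le sym_mats_iff)
  show "cp_le n (n * (n + 1) div 2 - 5) (\<lambda>i j. M $$ (i, j))"
  proof (rule cp_le_boundary_positive[OF n cp])
    show "0 < M $$ (i, j)" if "i < n" "j < n" for i j using pos that by blast
    fix e :: real assume "e > 0"
    then obtain X where X: "X \<in> sym_mats n" "X \<notin> cp_cone n" "frobenius_dist n M X < e"
      using M'(3) by blast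
    then show "\<exists>X. symmetric n X \<and> \<not> (\<exists>k. cp_le n k X) \<and> (\<forall>i<n. \<forall>j<n. \<bar>X i j - M $$ (i, j)\<bar> < e)"
      using near[OF X(3)]
      by (intro exI[of _ "\<lambda>i j. X $$ (i, j)"]) (auto simp: cp_cone_iff_cp_le sym_mats_iff)
  qed
qed

text \<open>This makes the set in \<open>p_star_max\<close> nonempty. Lowering the entry at (0, 0)
  by any positive amount leaves the cone, since the quadratic form becomes negative at
  \<open>e_0 - e_1\<close>.\<close>

lemma all_ones_in_bd_cp_cone:
  assumes n: "n \<ge> 2"
  shows "mat n n (\<lambda>_. 1) \<in> bd_cp_cone n"
proof -
  let ?J = "mat n n (\<lambda>_. 1) :: real mat"
  have "cp_decomp n {0} (\<lambda>_ _. 1) (\<lambda>_ _. 1)" by (simp add: cp_decomp_def)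
  then have "cp_le n 1 (\<lambda>_ _. 1)" unfolding cp_le_def by force
  then have "cp_le n 1 (\<lambda>i j. ?J $$ (i, j))" by (subst cp_le_cong[of n _ "\<lambda>_ _. 1"]) auto
  then have J: "?J \<in> cp_cone n" by (auto simp: cp_cone_iff_cp_le)
  have "\<exists>X\<in>sym_mats n. X \<notin> cp_cone n \<and> frobenius_dist n ?J X < e" if e: "e > 0" for e
  proof -
    define X where "X = mat n n (\<lambda>(i, j). 1 - (if i = 0 \<and> j = 0 then e / 2 else 0))"
    have X: "X $$ (i, j) = 1 - (if i = 0 \<and> j = 0 then e / 2 else 0)" if "i < n" "j < n" for i j
      using that by (simp add: X_def)
    have "X \<in> sym_mats n" using X by (simp add: sym_mats_iff symmetric_def X_def)
    moreover have "X \<notin> cp_cone n"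
    proof
      assume "X \<in> cp_cone n"
      then obtain L v where dec: "cp_decomp n L v (\<lambda>i j. X $$ (i, j))"
        by (auto simp: cp_cone_iff_cp_le cp_le_def)
      have "0 \<le> (\<Sum>l\<in>L. (v l 0 - v l 1) * (v l 0 - v l 1))" by (intro sum_nonneg) simp
      also have "\<dots> = X $$ (0, 0) - 2 * X $$ (0, 1) + X $$ (1, 1)"
        using n cp_decompD(3)[OF dec, of 0 0] cp_decompD(3)[OF dec, of 0 1] cp_decompD(3)[OF dec, of 1 1]
        by (simp add: algebra_simps sum.distrib sum_subtractf flip: sum_distrib_left)
      also have "\<dots> = - e / 2" using n by (simp add: X)
      finally show False using e by simp
    qed
    moreover have "frobenius_dist n ?J X \<le> e / 2"
    proof -
      have "frobenius_dist n ?J X \<le> (\<Sum>p\<in>{..<n} \<times> {..<n}. \<bar>case p of (i, j) \<Rightarrow> ?J $$ (i, j) - X $$ (i, j)\<bar>)"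
        unfolding frobenius_dist_def by (rule L2_set_le_sum_abs)
      also have "\<dots> = (\<Sum>p\<in>{(0 :: nat, 0 :: nat)}. e / 2)"
        by (rule sum.mono_neutral_cong_right) (use n e in \<open>auto simp: X split: if_splits\<close>)
      finally show ?thesis by simp
    qed
    ultimately show ?thesis using e by (intro bexI[of _ X]) auto
  qed
  moreover have "frobenius_dist n ?J ?J = 0" by (simp add: frobenius_dist_def L2_set_def)
  ultimately show ?thesis
    unfolding bd_cp_cone_iff using J cp_cone_subset_sym_mats[of n] by force
qed

lemma p_star_max_le:
  assumes n: "n \<ge> 5"
  shows "p_star_max n \<le> n * (n + 1) div 2 - 5"
proof -
  let ?R = "cp_rank ` {M \<in> bd_cp_cone n. \<forall>i<n. \<forall>j<n. M $$ (i, j) > 0}"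
  have le: "r \<le> n * (n + 1) div 2 - 5" if r: "r \<in> ?R" for r
  proof -
    obtain M where M: "r = cp_rank M" "M \<in> bd_cp_cone n" "\<And>i j. i < n \<Longrightarrow> j < n \<Longrightarrow> M $$ (i, j) > 0"
      using r by blast
    then show ?thesis
      using bd_cp_cone_positive_cp_le[OF n M(2,3)] cp_rank_le_iff by blast
  qed
  have fin: "finite ?R" unfolding finite_nat_set_iff_bounded_le using le by (intro exI ballI)
  have "mat n n (\<lambda>_. 1) \<in> {M \<in> bd_cp_cone n. \<forall>i<n. \<forall>j<n. M $$ (i, j) > 0}"
    using all_ones_in_bd_cp_cone[of n] n by simp
  then have ne: "?R \<noteq> {}" by (metis (no_types, lifting) empty_iff image_is_empty)
  show ?thesis unfolding p_star_max_def by (rule Max.boundedI[OF fin ne le])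
qed

lemma p_max_le:
  assumes n: "n \<ge> 5"
  shows "p_max n \<le> n * (n + 1) div 2 - 4"
proof -
  have le: "r \<le> n * (n + 1) div 2 - 4" if r: "r \<in> cp_rank ` cp_cone n" for r
  proof -
    obtain M where M: "r = cp_rank M" "M \<in> cp_cone n" using r by blast
    then have "cp_le n (n * (n + 1) div 2 - 4) (\<lambda>i j. M $$ (i, j))"
      using cp_le_improved[OF n] unfolding cp_cone_iff_cp_le by blast
    then show ?thesis using M cp_rank_le_iff by blast
  qed
  have fin: "finite (cp_rank ` cp_cone n)"
    unfolding finite_nat_set_iff_bounded_le using le by (intro exI ballI)
  \<comment> \<open>The zero matrix shows that the set of cp-ranks is nonempty.\<close>
  have "cp_le n 0 (\<lambda>i j. 0\<^sub>m n n $$ (i, j))"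
    unfolding cp_le_def by (intro exI[of _ "{}"]) (auto simp: cp_decomp_def)
  then have "0\<^sub>m n n \<in> cp_cone n" by (auto simp: cp_cone_iff_cp_le)
  then have ne: "cp_rank ` cp_cone n \<noteq> {}" by blast
  show ?thesis unfolding p_max_def by (rule Max.boundedI[OF fin ne le])
qed

theorem corollary5p2:
  fixes n :: nat
  assumes "n \<ge> 5"
  shows "int (p_star_max n) \<le> int (b_max n) - 4 \<and> int (p_max n) \<le> int (b_max n) - 3"
proof -
  \<comment> \<open>Since \<open>N \<ge> 5\<close>, the truncated subtractions agree with those of
    integers, and \<open>b_max n \<ge> N - 1\<close> turns \<open>N - 5\<close> and
    \<open>N - 4\<close> into the two bounds.\<close>
  have "10 \<le> n * (n + 1)" using assms mult_le_mono[of 5 n 2 "n + 1"] by simp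
  then have "n * (n + 1) div 2 \<ge> 5" using div_le_mono[of 10 "n * (n + 1)" 2] by simp
  then show ?thesis
    using p_star_max_le[OF assms] p_max_le[OF assms] b_max_ge[of n] assms by linarith
qed

end
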